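(* Let $p,q\ge 1$ and let ${\bf A}$ be a $\mathbb{Z}^p$-action on $\mathbb{Z}^q$ with $\mathrm{Fix}({\bf A})\neq\{0\}$. Let $\mathbb{Z}^q=\mathbb{Z}^{q_1}\times\mathbb{Z}^{q_2}$ be a direct product decomposition with respect to which $${\bf A}(\ell)(x,y)=({\bf A}_1(\ell)(x),\,{\bf V}(\ell)(x)+{\bf A}_2(\ell)(y)),\qquad \ell\in\mathbb{Z}^p,\ x\in\mathbb{Z}^{q_1},\ y\in\mathbb{Z}^{q_2},$$ where ${\bf A}_1$ is a unipotent $\mathbb{Z}^p$-action on $\mathbb{Z}^{q_1}$, ${\bf A}_2$ is a $\mathbb{Z}^p$-action on $\mathbb{Z}^{q_2}$ with $\mathrm{Fix}({\bf A}_2)=\{0\}$, and ${\bf V}:\mathbb{Z}^p\to\mathrm{Hom}_{\mathbb{Z}}(\mathbb{Z}^{q_1},\mathbb{Z}^{q_2})$ is a map satisfying ${\bf V}(\ell+\ell')={\bf V}(\ell)\circ{\bf A}_1(\ell')+{\bf A}_2(\ell)\circ{\bf V}(\ell')$ for all $\ell,\ell'\in\mathbb{Z}^p$. Then ${\bf A}$ is liberated affine if and only if the unipotent action ${\bf A}_1$ is liberated affine.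
   Context: A $\mathbb{Z}^p$-action on $\mathbb{Z}^q$ is a homomorphism ${\bf A}:\mathbb{Z}^p\to\mathrm{Aut}(\mathbb{Z}^q)=GL(q,\mathbb{Z})$, and $\mathrm{Fix}({\bf A})=\{k\in\mathbb{Z}^q : {\bf A}(\ell)k=k \text{ for all } \ell\in\mathbb{Z}^p\}$. It is unipotent if every ${\bf A}(\ell)$ is a unipotent automorphism. It is known that every $\mathbb{Z}^p$-action on $\mathbb{Z}^q$ with non-zero fixed-point set admits a decomposition of the kind described in the claim. Let $T^q=\mathbb{R}^q/\mathbb{Z}^q$ and let $\mathrm{Affine}(T^q)$ be the group of affine transformations ${\bf x}\mapsto B{\bf x}+{\bf a}$ of $T^q$, with $B\in GL(q,\mathbb{Z})$ and ${\bf a}\in T^q$. An affine $\mathbb{Z}^p$-action on $T^q$ is a homomorphism $\varphi:\mathbb{Z}^p\to\mathrm{Affine}(T^q)$; $\varphi_*$ denotes the induced $\mathbb{Z}^p$-action on $H_1(T^q,\mathbb{Z})=\mathbb{Z}^q$ (the linear part of $\varphi$). The action $\varphi$ is free if $\varphi(\ell)$ has no fixed point on $T^q$ for every $\ell\in\mathbb{Z}^p-\{0\}$. A $\mathbb{Z}^p$-action ${\bf A}$ on $\mathbb{Z}^q$ is liberated affine if there is a free affine $\mathbb{Z}^p$-action $\varphi$ on $T^q$ with $\varphi_*={\bf A}$. *)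

theory Defs
  imports Complex_Main "HOL-Algebra.Coset" "Jordan_Normal_Form.Matrix"
begin

section \<open>Integral lattices and their actions\<close>

text \<open>Matrices and vectors with an explicit dimension are used, rather than dimensions
  coded as types, because a factor of a decomposition may have dimension zero.\<close>

abbreviation Zpow :: "nat \<Rightarrow> int vec monoid" where
  "Zpow n \<equiv> monoid_vec TYPE(int) n"

definition GLZ :: "nat \<Rightarrow> int mat monoid" where
  "GLZ n = units_of (ring_mat TYPE(int) n ())"

definition lattice_action :: "nat \<Rightarrow> nat \<Rightarrow> (int vec \<Rightarrow> int mat) \<Rightarrow> bool" where
  "lattice_action p q A \<longleftrightarrow> A \<in> hom (Zpow p) (GLZ q)"

definition Fix :: "nat \<Rightarrow> nat \<Rightarrow> (int vec \<Rightarrow> int mat) \<Rightarrow> int vec set" where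
  "Fix p q A = {k \<in> carrier (Zpow q). \<forall>l \<in> carrier (Zpow p). A l *\<^sub>v k = k}"

definition unipotent_mat :: "nat \<Rightarrow> int mat \<Rightarrow> bool" where
  "unipotent_mat n B \<longleftrightarrow> B \<in> carrier_mat n n \<and> (\<exists>k. (B - 1\<^sub>m n) ^\<^sub>m k = 0\<^sub>m n n)"

definition unipotent_action :: "nat \<Rightarrow> nat \<Rightarrow> (int vec \<Rightarrow> int mat) \<Rightarrow> bool" where
  "unipotent_action p q A \<longleftrightarrow>
     lattice_action p q A \<and> (\<forall>l \<in> carrier (Zpow p). unipotent_mat q (A l))"


section \<open>The torus and its affine transformations\<close>

abbreviation Rpow :: "nat \<Rightarrow> real vec monoid" where
  "Rpow n \<equiv> monoid_vec TYPE(real) n"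

definition integer_lattice :: "nat \<Rightarrow> real vec set" where
  "integer_lattice n = map_vec real_of_int ` carrier_vec n"

definition torus :: "nat \<Rightarrow> real vec set monoid" where
  "torus n = Rpow n Mod integer_lattice n"

text \<open>A point of the torus is a coset of the integer lattice. An invertible integer matrix
  maps such a coset onto a coset, so that the linear part may act by taking images;
  the translation part acts by the multiplication of the group \<^const>\<open>torus\<close>,
  that is, by addition of cosets. See \<open>affine_map_coset\<close> below.\<close>

definition affine_map :: "nat \<Rightarrow> int mat \<Rightarrow> real vec set \<Rightarrow> real vec set \<Rightarrow> real vec set" where
  "affine_map n B a =
     (\<lambda>X \<in> carrier (torus n). (\<lambda>v. map_mat real_of_int B *\<^sub>v v) ` X \<otimes>\<^bsub>torus n\<^esub> a)"

definition affine_group :: "nat \<Rightarrow> (real vec set \<Rightarrow> real vec set) monoid" where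
  "affine_group n =
     \<lparr>carrier = {affine_map n B a | B a. B \<in> carrier (GLZ n) \<and> a \<in> carrier (torus n)},
      monoid.mult = compose (carrier (torus n)),
      one = (\<lambda>X \<in> carrier (torus n). X)\<rparr>"

definition linear_part :: "nat \<Rightarrow> (real vec set \<Rightarrow> real vec set) \<Rightarrow> int mat" where
  "linear_part n f =
     (THE B. B \<in> carrier (GLZ n) \<and> (\<exists>a \<in> carrier (torus n). f = affine_map n B a))"

definition affine_action ::
    "nat \<Rightarrow> nat \<Rightarrow> (int vec \<Rightarrow> real vec set \<Rightarrow> real vec set) \<Rightarrow> bool" where
  "affine_action p q \<phi> \<longleftrightarrow> \<phi> \<in> hom (Zpow p) (affine_group q)"

definition free_action ::
    "nat \<Rightarrow> nat \<Rightarrow> (int vec \<Rightarrow> real vec set \<Rightarrow> real vec set) \<Rightarrow> bool" where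
  "free_action p q \<phi> \<longleftrightarrow>
     (\<forall>l \<in> carrier (Zpow p) - {0\<^sub>v p}. \<forall>X \<in> carrier (torus q). \<phi> l X \<noteq> X)"

definition liberated_affine :: "nat \<Rightarrow> nat \<Rightarrow> (int vec \<Rightarrow> int mat) \<Rightarrow> bool" where
  "liberated_affine p q A \<longleftrightarrow>
     (\<exists>\<phi>. affine_action p q \<phi> \<and> free_action p q \<phi> \<and>
          (\<forall>l \<in> carrier (Zpow p). linear_part q (\<phi> l) = A l))"


section \<open>Well-definedness\<close>

abbreviation torus_point :: "nat \<Rightarrow> real vec \<Rightarrow> real vec set" where
  "torus_point n v \<equiv> integer_lattice n #>\<^bsub>Rpow n\<^esub> v"

lemma carrier_GLZ:
  "carrier (GLZ n) = {B \<in> carrier_mat n n. \<exists>C \<in> carrier_mat n n. C * B = 1\<^sub>m n \<and> B * C = 1\<^sub>m n}"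
  by (auto simp: GLZ_def units_of_def Units_def ring_mat_simps)

lemma mult_GLZ: "monoid.mult (GLZ n) = (*)"
  by (simp add: GLZ_def units_of_def ring_mat_simps)

lemma group_GLZ: "group (GLZ n)"
proof -
  interpret ring "ring_mat TYPE(int) n ()" by (rule ring_mat)
  show ?thesis unfolding GLZ_def by (rule units_group)
qed

lemma normal_integer_lattice: "normal (integer_lattice n) (Rpow n)"
proof -
  interpret comm_group "Rpow n" by (rule comm_group_vec)
  have "subgroup (integer_lattice n) (Rpow n)"
  proof (rule subgroupI)
    show "integer_lattice n \<noteq> {}"
      by (auto simp: integer_lattice_def intro: zero_carrier_vec)
    fix a assume "a \<in> integer_lattice n"
    then obtain u where u: "u \<in> carrier_vec n" "a = map_vec real_of_int u"
      by (auto simp: integer_lattice_def)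
    have "inv\<^bsub>Rpow n\<^esub> a = map_vec real_of_int (- u)"
      by (rule inv_equality) (use u in \<open>auto simp: monoid_vec_simps\<close>)
    then show "inv\<^bsub>Rpow n\<^esub> a \<in> integer_lattice n"
      using u by (auto simp: integer_lattice_def)
    fix b assume "b \<in> integer_lattice n"
    then obtain w where w: "w \<in> carrier_vec n" "b = map_vec real_of_int w"
      by (auto simp: integer_lattice_def)
    have "a + b = map_vec real_of_int (u + w)" using u w by auto
    then show "a \<otimes>\<^bsub>Rpow n\<^esub> b \<in> integer_lattice n"
      using u w by (auto simp: integer_lattice_def monoid_vec_simps)
  qed (auto simp: integer_lattice_def monoid_vec_simps)
  then show ?thesis by (rule subgroup_imp_normal)
qed

lemma group_torus: "group (torus n)"
  unfolding torus_def by (rule normal.factorgroup_is_group[OF normal_integer_lattice])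

lemma carrier_torus: "carrier (torus n) = torus_point n ` carrier_vec n"
  by (auto simp: torus_def FactGroup_def RCOSETS_def monoid_vec_simps)

lemma torus_point_closed: "v \<in> carrier_vec n \<Longrightarrow> torus_point n v \<in> carrier (torus n)"
  by (simp add: carrier_torus)

lemma mult_torus:
  assumes "v \<in> carrier_vec n" "w \<in> carrier_vec n"
  shows "torus_point n v \<otimes>\<^bsub>torus n\<^esub> torus_point n w = torus_point n (v + w)"
  using normal.rcos_sum[OF normal_integer_lattice, of v n w] assms
  by (simp add: torus_def FactGroup_def monoid_vec_simps)

lemma torus_point_eq_iff:
  assumes "v \<in> carrier_vec n" "w \<in> carrier_vec n"
  shows "torus_point n v = torus_point n w \<longleftrightarrow> v - w \<in> integer_lattice n"
proof -
  interpret N: normal "integer_lattice n" "Rpow n" by (rule normal_integer_lattice)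
  have *: "v \<in> torus_point n w \<longleftrightarrow> v - w \<in> integer_lattice n"
  proof
    assume "v \<in> torus_point n w"
    then obtain h where h: "h \<in> integer_lattice n" "v = h + w"
      by (auto simp: r_coset_def monoid_vec_simps)
    have "h \<in> carrier_vec n" using h by (auto simp: integer_lattice_def)
    then have "v - w = h" using assms h by (intro eq_vecI) auto
    then show "v - w \<in> integer_lattice n" using h by simp
  next
    assume h: "v - w \<in> integer_lattice n"
    have "v = (v - w) + w" using assms by auto
    with h show "v \<in> torus_point n w" by (auto simp: r_coset_def monoid_vec_simps)
  qed
  show ?thesis
    unfolding *[symmetric]
    using N.repr_independence[of v "integer_lattice n" w] N.rcos_self[of v "integer_lattice n"]
      assms N.subgroup_axioms
    by (auto simp: monoid_vec_simps)
qed

lemma torus_lin_coset: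
  assumes "B \<in> carrier (GLZ n)" "v \<in> carrier_vec n"
  shows "(\<lambda>x. map_mat real_of_int B *\<^sub>v x) ` torus_point n v =
           torus_point n (map_mat real_of_int B *\<^sub>v v)"
proof -
  from assms obtain C where B: "B \<in> carrier_mat n n"
    and C: "C \<in> carrier_mat n n" "B * C = 1\<^sub>m n"
    by (auto simp: carrier_GLZ)
  let ?B = "map_mat real_of_int B"
  have hom: "?B *\<^sub>v map_vec real_of_int u = map_vec real_of_int (B *\<^sub>v u)"
    if "u \<in> carrier_vec n" for u
    using of_int_hom.mult_mat_vec_hom[OF B that] by metis
  have add: "?B *\<^sub>v (x + v) = ?B *\<^sub>v x + ?B *\<^sub>v v" if "x \<in> carrier_vec n" for x
    using B assms that by (intro mult_add_distrib_mat_vec) auto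
  have "\<exists>u' \<in> carrier_vec n. B *\<^sub>v u' = u" if "u \<in> carrier_vec n" for u
  proof
    have "B *\<^sub>v (C *\<^sub>v u) = (B * C) *\<^sub>v u"
      by (rule assoc_mult_mat_vec[OF B C(1) that, symmetric])
    then show "B *\<^sub>v (C *\<^sub>v u) = u" using C(2) that by simp
  qed (use C that in auto)
  then have surj: "(\<lambda>u. B *\<^sub>v u) ` carrier_vec n = carrier_vec n"
    using B by (fastforce simp: image_iff)
  have "(\<lambda>x. ?B *\<^sub>v x) ` integer_lattice n
      = map_vec real_of_int ` (\<lambda>u. B *\<^sub>v u) ` carrier_vec n"
    unfolding integer_lattice_def image_image by (intro image_cong refl hom)
  then have img: "(\<lambda>x. ?B *\<^sub>v x) ` integer_lattice n = integer_lattice n"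
    unfolding surj integer_lattice_def .
  have "(\<lambda>x. ?B *\<^sub>v x) ` torus_point n v = (\<lambda>x. ?B *\<^sub>v (x + v)) ` integer_lattice n"
    by (auto simp: r_coset_def monoid_vec_simps)
  also have "\<dots> = (\<lambda>x. ?B *\<^sub>v x + ?B *\<^sub>v v) ` integer_lattice n"
    by (intro image_cong refl add) (auto simp: integer_lattice_def)
  also have "\<dots> = (\<lambda>y. y + ?B *\<^sub>v v) ` (\<lambda>x. ?B *\<^sub>v x) ` integer_lattice n"
    by (simp add: image_image)
  also have "\<dots> = torus_point n (?B *\<^sub>v v)"
    unfolding img by (auto simp: r_coset_def monoid_vec_simps)
  finally show ?thesis .
qed

lemma affine_map_coset:
  assumes "B \<in> carrier (GLZ n)" "v \<in> carrier_vec n" "w \<in> carrier_vec n"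
  shows "affine_map n B (torus_point n w) (torus_point n v) =
           torus_point n (map_mat real_of_int B *\<^sub>v v + w)"
proof -
  have "map_mat real_of_int B *\<^sub>v v \<in> carrier_vec n" using assms by (auto simp: carrier_GLZ)
  then show ?thesis
    using assms by (simp add: affine_map_def torus_point_closed torus_lin_coset mult_torus)
qed

lemma affine_map_linear_unique:
  assumes B: "B \<in> carrier (GLZ n)" and C: "C \<in> carrier (GLZ n)"
    and a: "a \<in> carrier (torus n)" and b: "b \<in> carrier (torus n)"
    and eq: "affine_map n B a = affine_map n C b"
  shows "B = C"
proof -
  obtain v w where v: "v \<in> carrier_vec n" "a = torus_point n v"
    and w: "w \<in> carrier_vec n" "b = torus_point n w"
    using a b by (auto simp: carrier_torus)
  have Bc: "B \<in> carrier_mat n n" and Cc: "C \<in> carrier_mat n n"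
    using B C by (auto simp: carrier_GLZ)
  let ?B = "map_mat real_of_int B" and ?C = "map_mat real_of_int C"
  have key: "(?B *\<^sub>v x + v) - (?C *\<^sub>v x + w) \<in> integer_lattice n" if x: "x \<in> carrier_vec n" for x
  proof -
    have "torus_point n (?B *\<^sub>v x + v) = torus_point n (?C *\<^sub>v x + w)"
      using fun_cong[OF eq, of "torus_point n x"] affine_map_coset[OF B x v(1)]
        affine_map_coset[OF C x w(1)] v w by simp
    then show ?thesis
      using torus_point_eq_iff[of "?B *\<^sub>v x + v" n "?C *\<^sub>v x + w"] Bc Cc x v w by simp
  qed
  have int: "u $ i \<in> \<int>" if "u \<in> integer_lattice n" "i < n" for u i
    using that by (auto simp: integer_lattice_def)
  show ?thesis
  proof (rule eq_matI)
    fix i j assume "i < dim_row C" "j < dim_col C"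
    then have ij: "i < n" "j < n" using Cc by auto
    define d where "d = B $$ (i, j) - C $$ (i, j)"
    define t :: real where "t = 1 / (2 * (\<bar>real_of_int d\<bar> + 1))"
    have ent: "(D *\<^sub>v (s \<cdot>\<^sub>v unit_vec n j)) $ i = s * D $$ (i, j)"
      if "D \<in> carrier_mat n n" for D :: "real mat" and s
      using that ij by (simp add: scalar_prod_smult_right scalar_prod_right_unit)
    let ?x = "t \<cdot>\<^sub>v unit_vec n j"
    have "((?B *\<^sub>v ?x + v) - (?C *\<^sub>v ?x + w)) $ i \<in> \<int>"
      using ij by (intro int key) auto
    moreover have "((?B *\<^sub>v ?x + v) - (?C *\<^sub>v ?x + w)) $ i
        = (?B *\<^sub>v ?x) $ i + v $ i - ((?C *\<^sub>v ?x) $ i + w $ i)"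
      using Bc Cc v w ij by (simp del: index_mult_mat_vec)
    moreover have "\<dots> = t * real_of_int d + (v $ i - w $ i)"
      using Bc Cc ij by (simp add: ent d_def algebra_simps del: index_mult_mat_vec)
    ultimately have 1: "t * real_of_int d + (v $ i - w $ i) \<in> \<int>" by simp
    have "((?B *\<^sub>v 0\<^sub>v n + v) - (?C *\<^sub>v 0\<^sub>v n + w)) $ i \<in> \<int>"
      using ij by (intro int key) auto
    moreover have "((?B *\<^sub>v 0\<^sub>v n + v) - (?C *\<^sub>v 0\<^sub>v n + w)) $ i = v $ i - w $ i"
      using Bc Cc v w ij by simp
    ultimately have 2: "v $ i - w $ i \<in> \<int>" by simp
    have "t * real_of_int d \<in> \<int>"
      using Ints_diff[OF 1 2] by simp
    moreover have "\<bar>t * real_of_int d\<bar> < 1"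
      by (simp add: t_def abs_mult divide_simps)
    ultimately have "t * real_of_int d = 0"
      by (metis Ints_nonzero_abs_less1)
    moreover have "t \<noteq> 0" by (simp add: t_def)
    ultimately have "d = 0" by simp
    then show "B $$ (i, j) = C $$ (i, j)" by (simp add: d_def)
  qed (use Bc Cc in auto)
qed

lemma linear_part_affine_map:
  assumes "B \<in> carrier (GLZ n)" "a \<in> carrier (torus n)"
  shows "linear_part n (affine_map n B a) = B"
  unfolding linear_part_def
  using assms by (intro the_equality) (auto dest: affine_map_linear_unique)

lemma affine_map_closed:
  assumes "B \<in> carrier (GLZ n)" "a \<in> carrier (torus n)"
  shows "affine_map n B a \<in> carrier (torus n) \<rightarrow> carrier (torus n)"
proof
  fix X assume "X \<in> carrier (torus n)"
  then obtain v where v: "v \<in> carrier_vec n" "X = torus_point n v" by (auto simp: carrier_torus)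
  obtain w where w: "w \<in> carrier_vec n" "a = torus_point n w"
    using assms by (auto simp: carrier_torus)
  have "map_mat real_of_int B *\<^sub>v v + w \<in> carrier_vec n"
    using assms v w by (auto simp: carrier_GLZ)
  then show "affine_map n B a X \<in> carrier (torus n)"
    using assms v w by (simp add: affine_map_coset torus_point_closed)
qed

lemma compose_affine_map:
  assumes B: "B \<in> carrier (GLZ n)" and C: "C \<in> carrier (GLZ n)"
    and v: "v \<in> carrier_vec n" and w: "w \<in> carrier_vec n"
  shows "compose (carrier (torus n)) (affine_map n B (torus_point n v)) (affine_map n C (torus_point n w))
       = affine_map n (B * C) (torus_point n (map_mat real_of_int B *\<^sub>v w + v))"
    (is "?l = ?r")
proof
  fix X
  have Bc: "B \<in> carrier_mat n n" and Cc: "C \<in> carrier_mat n n"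
    using B C by (auto simp: carrier_GLZ)
  have BC: "B * C \<in> carrier (GLZ n)"
    using monoid.m_closed[OF group.is_monoid[OF group_GLZ] B C] by (simp add: mult_GLZ)
  let ?B = "map_mat real_of_int B" and ?C = "map_mat real_of_int C"
  show "?l X = ?r X"
  proof (cases "X \<in> carrier (torus n)")
    case True
    then obtain x where x: "x \<in> carrier_vec n" "X = torus_point n x" by (auto simp: carrier_torus)
    have Cx: "?C *\<^sub>v x \<in> carrier_vec n" and Bw: "?B *\<^sub>v w \<in> carrier_vec n"
      using Bc Cc x w by auto
    have "?B *\<^sub>v (?C *\<^sub>v x + w) + v = ?B *\<^sub>v (?C *\<^sub>v x) + ?B *\<^sub>v w + v"
      using Bc Cx w by (subst mult_add_distrib_mat_vec) auto
    also have "?B *\<^sub>v (?C *\<^sub>v x) = (?B * ?C) *\<^sub>v x"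
      using Bc Cc x by (intro assoc_mult_mat_vec[symmetric]) auto
    also have "?B * ?C = map_mat real_of_int (B * C)"
      by (rule of_int_hom.mat_hom_mult[OF Bc Cc, symmetric])
    also have "map_mat real_of_int (B * C) *\<^sub>v x + ?B *\<^sub>v w + v
        = map_mat real_of_int (B * C) *\<^sub>v x + (?B *\<^sub>v w + v)"
      by (rule assoc_add_vec[of _ n]) (use mult_mat_vec_carrier[of "map_mat real_of_int (B * C)" n n x] Bc Cc x Bw v in auto)
    finally have *: "?B *\<^sub>v (?C *\<^sub>v x + w) + v
        = map_mat real_of_int (B * C) *\<^sub>v x + (?B *\<^sub>v w + v)" .
    have "?l X = affine_map n B (torus_point n v) (torus_point n (?C *\<^sub>v x + w))"
      using True affine_map_coset[OF C x(1) w] x by (simp add: compose_def)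
    also have "\<dots> = torus_point n (?B *\<^sub>v (?C *\<^sub>v x + w) + v)"
      by (rule affine_map_coset[OF B _ v]) (use Cx w in auto)
    also have "\<dots> = ?r X"
      unfolding * x(2) by (rule affine_map_coset[OF BC x(1), symmetric]) (use Bw v in auto)
    finally show ?thesis .
  qed (simp_all add: compose_def affine_map_def)
qed

lemma affine_map_one:
  "affine_map n (1\<^sub>m n) (torus_point n (0\<^sub>v n)) = (\<lambda>X \<in> carrier (torus n). X)"
proof
  fix X
  have 1: "1\<^sub>m n \<in> carrier (GLZ n)" by (auto simp: carrier_GLZ)
  show "affine_map n (1\<^sub>m n) (torus_point n (0\<^sub>v n)) X = (\<lambda>X \<in> carrier (torus n). X) X"
  proof (cases "X \<in> carrier (torus n)")
    case True
    then obtain v where v: "v \<in> carrier_vec n" "X = torus_point n v" by (auto simp: carrier_torus)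
    then show ?thesis
      using True affine_map_coset[OF 1 v(1) zero_carrier_vec] by (simp add: of_int_hom.mat_hom_one)
  qed (simp add: affine_map_def)
qed

lemma group_affine_group: "group (affine_group n)"
proof (rule groupI)
  have one: "1\<^sub>m n \<in> carrier (GLZ n)" by (auto simp: carrier_GLZ)
  show "\<one>\<^bsub>affine_group n\<^esub> \<in> carrier (affine_group n)"
    using one torus_point_closed[of "0\<^sub>v n" n] affine_map_one[of n, symmetric]
    by (auto simp: affine_group_def)
  fix f assume f: "f \<in> carrier (affine_group n)"
  then obtain B v where B: "B \<in> carrier (GLZ n)" and v: "v \<in> carrier_vec n"
    and f_eq: "f = affine_map n B (torus_point n v)"
    by (auto simp: affine_group_def carrier_torus)
  have f_fun: "f \<in> carrier (torus n) \<rightarrow> carrier (torus n)"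
    unfolding f_eq by (rule affine_map_closed[OF B torus_point_closed[OF v]])
  have f_ext: "f \<in> extensional (carrier (torus n))"
    unfolding f_eq affine_map_def by simp
  show "\<one>\<^bsub>affine_group n\<^esub> \<otimes>\<^bsub>affine_group n\<^esub> f = f"
    using Id_compose[OF f_fun f_ext] by (simp add: affine_group_def)
  from B obtain C where C: "C \<in> carrier (GLZ n)" "C * B = 1\<^sub>m n"
    by (auto simp: carrier_GLZ)
  let ?C = "map_mat real_of_int C"
  have Cv: "?C *\<^sub>v v \<in> carrier_vec n" using C v by (auto simp: carrier_GLZ)
  let ?g = "affine_map n C (torus_point n (- (?C *\<^sub>v v)))"
  have "compose (carrier (torus n)) ?g f
      = affine_map n (1\<^sub>m n) (torus_point n (?C *\<^sub>v v + - (?C *\<^sub>v v)))"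
    unfolding f_eq by (subst compose_affine_map) (use B C v Cv in auto)
  also have "?C *\<^sub>v v + - (?C *\<^sub>v v) = 0\<^sub>v n" using Cv by (intro eq_vecI) auto
  finally have "?g \<otimes>\<^bsub>affine_group n\<^esub> f = \<one>\<^bsub>affine_group n\<^esub>"
    by (simp add: affine_group_def affine_map_one restrict_def)
  moreover have "torus_point n (- (?C *\<^sub>v v)) \<in> carrier (torus n)"
    using Cv by (intro torus_point_closed) auto
  then have "?g \<in> carrier (affine_group n)"
    using C by (auto simp: affine_group_def)
  ultimately show "\<exists>g \<in> carrier (affine_group n). g \<otimes>\<^bsub>affine_group n\<^esub> f = \<one>\<^bsub>affine_group n\<^esub>"
    by blast
  fix g assume g: "g \<in> carrier (affine_group n)"
  then obtain D w where D: "D \<in> carrier (GLZ n)" and w: "w \<in> carrier_vec n"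
    and g_eq: "g = affine_map n D (torus_point n w)"
    by (auto simp: affine_group_def carrier_torus)
  have BD: "B * D \<in> carrier (GLZ n)"
    using monoid.m_closed[OF group.is_monoid[OF group_GLZ] B D] by (simp add: mult_GLZ)
  have "torus_point n (map_mat real_of_int B *\<^sub>v w + v) \<in> carrier (torus n)"
    using B v w by (intro torus_point_closed) (auto simp: carrier_GLZ)
  then show "f \<otimes>\<^bsub>affine_group n\<^esub> g \<in> carrier (affine_group n)"
    using BD compose_affine_map[OF B D v w] by (auto simp: affine_group_def f_eq g_eq)
  have g_fun: "g \<in> carrier (torus n) \<rightarrow> carrier (torus n)"
    unfolding g_eq by (rule affine_map_closed[OF D torus_point_closed[OF w]])
  fix h assume h: "h \<in> carrier (affine_group n)"
  then have h_fun: "h \<in> carrier (torus n) \<rightarrow> carrier (torus n)"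
    using affine_map_closed by (auto simp: affine_group_def)
  show "f \<otimes>\<^bsub>affine_group n\<^esub> g \<otimes>\<^bsub>affine_group n\<^esub> h
      = f \<otimes>\<^bsub>affine_group n\<^esub> (g \<otimes>\<^bsub>affine_group n\<^esub> h)"
    using compose_assoc[OF h_fun, of f g] by (simp add: affine_group_def)
qed

end

theory Submission
  imports Defs "Jordan_Normal_Form.Determinant"
begin

text \<open>An affine action with linear part \<open>A\<close> is a cocycle \<open>t\<close> of translations. A cocycle is intertwined
  along equivariant integer matrices, and if a non-zero multiple of \<open>t l\<close> is of the form
  \<open>(A l - 1) w\<close>, then some \<open>k l\<close> with \<open>k \<ge> 1\<close> has a fixed point, so freeness passes to multiples of \<open>t\<close>.
  Write \<open>S\<close> for the equivariant projection of \<open>\<int>\<^sup>q\<close> onto \<open>\<int>\<^bsup>q1\<^esup>\<close>. As \<open>A1\<close> is unipotent and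
  \<open>A2\<close> has no fixed vector, a polynomial \<open>u\<close> in the matrices of \<open>A\<close> vanishes on the kernel of \<open>S\<close>, acts as
  an integer \<open>N \<noteq> 0\<close> on \<open>\<int>\<^bsup>q1\<^esup>\<close>, and has \<open>N - u\<close> in the augmentation ideal, which kills cohomology. It
  factors as \<open>u = K S\<close> with \<open>K\<close> equivariant and \<open>S K = N\<close>. So \<open>S\<close> carries free cocycles of \<open>A\<close> to free
  cocycles of \<open>A1\<close>, and \<open>K\<close> carries them back.\<close>

text \<open>Freeness at \<open>l\<close> says that \<open>t l\<close> avoids the image of
  \<open>A l - 1\<close> on the torus. The obstacle is that \<int>^q need not split equivariantly:
  if a generator acts by 1 on \<int>^q1 = \<int>, by -1 on \<int>^q2 = \<int> and V takes the value
  1 there, the two eigenlattices span a sublattice of index two. So \<open>S\<close> has in general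
  an equivariant section only up to a factor N, and passing between \<open>A\<close> and
  \<open>A1\<close> costs this factor. Freeness survives because the error made on dividing by N is
  a torsion point: torsion points of bounded order are finite in number and \<open>A l\<close>
  permutes them, so the accumulated error vanishes at some multiple of \<open>l\<close>. A second
  obstacle is that single generators may fix non-zero vectors of the second factor; only their
  common fixed vectors vanish. Hence one polynomial per generator is taken, and the product is shown
  to vanish on the kernel of \<open>S\<close> by a common null vector argument. The augmentation
  ideal kills cohomology because \<int>^p is commutative: expanding
  \<open>t (k + l) = t (l + k)\<close> gives \<open>(A k - 1) t l = (A l - 1) t k\<close>, a
  coboundary in \<open>l\<close>.\<close>

section \<open>Polynomials in an integer matrix\<close>

text \<open>A zero row pads the system of m equations in m + 1 unknowns to a square one with
  determinant zero, and \<open>det_0_iff_vec_prod_zero\<close> over the integers then gives a kernel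
  vector that is already integral.\<close>

lemma integer_linear_dependence:
  fixes f :: "nat \<Rightarrow> nat \<Rightarrow> int"
  shows "\<exists>c. (\<exists>j\<le>m. c j \<noteq> 0) \<and> (\<forall>r<m. (\<Sum>j\<le>m. c j * f j r) = 0)"
proof -
  define M where "M = mat (Suc m) (Suc m) (\<lambda>(r, j). if r < m then f j r else 0)"
  have M: "M \<in> carrier_mat (Suc m) (Suc m)" by (simp add: M_def)
  have "det M = (\<Sum>j<Suc m. M $$ (m, j) * cofactor M m j)"
    by (rule laplace_expansion_row[OF M]) simp
  moreover have "\<dots> = 0" by (intro sum.neutral) (auto simp: M_def)
  ultimately have "det M = 0" by simp
  then obtain v where v: "v \<in> carrier_vec (Suc m)" "v \<noteq> 0\<^sub>v (Suc m)" "M *\<^sub>v v = 0\<^sub>v (Suc m)"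
    using det_0_iff_vec_prod_zero[OF M] by auto
  have "\<exists>j\<le>m. v $ j \<noteq> 0"
  proof (rule ccontr)
    assume "\<not> ?thesis"
    then have "v = 0\<^sub>v (Suc m)" using v(1) by (intro eq_vecI) auto
    with v show False by simp
  qed
  moreover have "(\<Sum>j\<le>m. v $ j * f j r) = 0" if "r < m" for r
  proof -
    have "(M *\<^sub>v v) $ r = (\<Sum>j<Suc m. f j r * v $ j)"
      using that v(1) by (auto simp: M_def scalar_prod_def lessThan_atLeast0 intro!: sum.cong)
    then show ?thesis
      using v(3) that by (simp only: lessThan_Suc_atMost) (simp add: mult.commute)
  qed
  ultimately show ?thesis by blast
qed

lemma zero_smult_one_mat: "0 \<cdot>\<^sub>m 1\<^sub>m n = (0\<^sub>m n n :: int mat)"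
  by (intro eq_matI) auto

text \<open>The constant term comes first, so that leading zeros of the list amount to a factor
  \<open>T ^\<^sub>m b\<close>; \<open>horner_lowest_term\<close> reads this factor off.\<close>

fun horner :: "nat \<Rightarrow> int mat \<Rightarrow> int list \<Rightarrow> int mat" where
  "horner n T [] = 0\<^sub>m n n"
| "horner n T (c # cs) = c \<cdot>\<^sub>m 1\<^sub>m n + T * horner n T cs"

lemma horner_carrier [simp]: "T \<in> carrier_mat n n \<Longrightarrow> horner n T cs \<in> carrier_mat n n"
  by (induction cs) auto

lemma pow_mat_Suc_left:
  assumes "(T :: 'a :: comm_ring_1 mat) \<in> carrier_mat n n"
  shows "T ^\<^sub>m Suc k = T * T ^\<^sub>m k"
  using assms by (induction k) (auto simp: assoc_mult_mat[of _ n n _ n _ n])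

lemma horner_snoc:
  assumes T: "T \<in> carrier_mat n n"
  shows "horner n T (cs @ [c]) = horner n T cs + c \<cdot>\<^sub>m T ^\<^sub>m length cs"
proof (induction cs)
  case Nil
  then show ?case using T by (intro eq_matI) auto
next
  case (Cons d cs)
  have "horner n T ((d # cs) @ [c]) = d \<cdot>\<^sub>m 1\<^sub>m n + (T * horner n T cs + T * (c \<cdot>\<^sub>m T ^\<^sub>m length cs))"
    using Cons T by (simp add: mult_add_distrib_mat[of _ n n _ n])
  also have "T * (c \<cdot>\<^sub>m T ^\<^sub>m length cs) = c \<cdot>\<^sub>m (T ^\<^sub>m Suc (length cs))"
    using T by (simp add: pow_mat_Suc_left mult_smult_distrib[of _ n n _ n] del: pow_mat.simps)
  finally show ?case
    using T by (simp add: assoc_add_mat[of _ n n, symmetric] del: pow_mat.simps)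
qed

lemma horner_index:
  assumes T: "T \<in> carrier_mat n n" and rs: "r < n" "s < n"
  shows "horner n T cs $$ (r, s) = (\<Sum>j<length cs. cs ! j * (T ^\<^sub>m j) $$ (r, s))"
proof (induction cs rule: rev_induct)
  case (snoc c cs)
  have "horner n T (cs @ [c]) $$ (r, s) = horner n T cs $$ (r, s) + c * (T ^\<^sub>m length cs) $$ (r, s)"
    using T rs by (simp add: horner_snoc carrier_matD[OF horner_carrier[OF T]])
  then show ?case using snoc by (simp add: nth_append)
qed (use rs in simp)

lemma horner_commute:
  assumes T: "T \<in> carrier_mat n n" and X: "X \<in> carrier_mat n n" and XT: "X * T = T * X"
  shows "X * horner n T cs = horner n T cs * X"
proof (induction cs)
  case (Cons c cs)
  let ?H = "horner n T cs"
  have H: "?H \<in> carrier_mat n n" using T by simp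
  have "X * (T * ?H) = T * X * ?H" using T X H by (simp add: assoc_mult_mat[of _ n n _ n _ n, symmetric] XT)
  also have "\<dots> = T * ?H * X" using T X H Cons by (simp add: assoc_mult_mat[of _ n n _ n _ n])
  finally show ?case
    using T X H by (simp add: mult_add_distrib_mat[of _ n n _ n] add_mult_distrib_mat[of _ n n _ _ n]
        mult_smult_distrib[of _ n n _ n] mult_smult_assoc_mat[of _ n n _ n] assoc_mult_mat[of _ n n _ n _ n])
qed (use X in simp)

text \<open>The n * n + 1 powers of \<open>T\<close> up to exponent n * n lie in a lattice of rank n
  * n, hence satisfy an integer relation.\<close>

lemma annihilating_horner:
  assumes T: "T \<in> carrier_mat n n"
  shows "\<exists>cs. horner n T cs = 0\<^sub>m n n \<and> (\<exists>c\<in>set cs. c \<noteq> 0)"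
proof -
  \<comment> \<open>Matrices are flattened row by row: the index \<open>r * n + s\<close> stands for
    the entry (r, s).\<close>
  obtain c where c: "\<exists>j\<le>n*n. c j \<noteq> (0::int)"
    "\<forall>r<n*n. (\<Sum>j\<le>n*n. c j * (T ^\<^sub>m j) $$ (r div n, r mod n)) = 0"
    using integer_linear_dependence[of "n*n" "\<lambda>j r. (T ^\<^sub>m j) $$ (r div n, r mod n)"] by blast
  let ?cs = "map c [0..<Suc (n*n)]"
  have "horner n T ?cs $$ (r, s) = 0" if rs: "r < n" "s < n" for r s
  proof -
    have "r * n + s < n * n"
    proof -
      have "r * n + s < Suc r * n" using rs by simp
      also have "\<dots> \<le> n * n" using rs by (intro mult_le_mono) auto
      finally show ?thesis .
    qed
    then have "(\<Sum>j\<le>n*n. c j * (T ^\<^sub>m j) $$ (r, s)) = 0"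
      using c(2)[rule_format, of "r * n + s"] rs by simp
    moreover have "horner n T ?cs $$ (r, s) = (\<Sum>j<Suc (n*n). c j * (T ^\<^sub>m j) $$ (r, s))"
      unfolding horner_index[OF T rs] by (intro sum.cong) (auto simp del: upt_Suc)
    ultimately show ?thesis by (simp add: lessThan_Suc_atMost)
  qed
  then have "horner n T ?cs = 0\<^sub>m n n"
    using carrier_matD[OF horner_carrier[OF T]] by (intro eq_matI) (auto simp del: upt_Suc)
  moreover have "\<exists>d\<in>set ?cs. d \<noteq> 0" using c(1) by (auto simp: le_imp_less_Suc simp del: upt_Suc)
  ultimately show ?thesis by blast
qed

text \<open>Isolating the lowest non-zero coefficient c allows \<open>c T^b\<close> to be expressed
  through higher powers of \<open>T\<close>, which is the source of the recursion in
  \<open>fitting_polynomial\<close>.\<close>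

lemma horner_lowest_term:
  assumes T: "T \<in> carrier_mat n n"
  shows "\<exists>c\<in>set cs. c \<noteq> 0 \<Longrightarrow>
    \<exists>b c ds. c \<noteq> 0 \<and> horner n T cs = T ^\<^sub>m b * (c \<cdot>\<^sub>m 1\<^sub>m n + T * horner n T ds)"
proof (induction cs)
  case (Cons c cs)
  show ?case
  proof (cases "c = 0")
    case False
    then show ?thesis using T by (intro exI[of _ 0] exI[of _ c] exI[of _ cs]) simp
  next
    case True
    then obtain b d ds where b: "d \<noteq> 0" "horner n T cs = T ^\<^sub>m b * (d \<cdot>\<^sub>m 1\<^sub>m n + T * horner n T ds)"
      using Cons by auto
    have "T * horner n T cs \<in> carrier_mat n n" using T by (intro mult_carrier_mat[of _ n n] horner_carrier)
    then have "horner n T (c # cs) = T * (T ^\<^sub>m b * (d \<cdot>\<^sub>m 1\<^sub>m n + T * horner n T ds))"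
      using True by (simp add: zero_smult_one_mat left_add_zero_mat[of _ n n] flip: b(2))
    also have "\<dots> = T ^\<^sub>m Suc b * (d \<cdot>\<^sub>m 1\<^sub>m n + T * horner n T ds)"
      using T by (simp add: pow_mat_Suc_left assoc_mult_mat[of _ n n _ n _ n] del: pow_mat.simps)
    finally show ?thesis using b by blast
  qed
qed simp

lemma pow_mat_commute:
  assumes T: "(T :: 'a :: comm_ring_1 mat) \<in> carrier_mat n n" and X: "X \<in> carrier_mat n n" and XT: "X * T = T * X"
  shows "X * T ^\<^sub>m k = T ^\<^sub>m k * X"
proof (induction k)
  case (Suc k)
  have "X * T ^\<^sub>m Suc k = X * T ^\<^sub>m k * T" using T X by (simp add: assoc_mult_mat[of _ n n _ n _ n])
  also have "\<dots> = T ^\<^sub>m k * (X * T)" using T X Suc by (simp add: assoc_mult_mat[of _ n n _ n _ n])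
  also have "\<dots> = T ^\<^sub>m Suc k * X" using T X XT by (simp add: assoc_mult_mat[of _ n n _ n _ n])
  finally show ?case .
qed (use T X in auto)

text \<open>An annihilating polynomial \<open>x\<^sup>b (c + x h(x))\<close> of \<open>T\<close> with \<open>c \<noteq> 0\<close> also gives
  \<open>T\<^sup>b (- T h(T))\<^sup>a = c\<^sup>a T\<^sup>b\<close>.\<close>

lemma fitting_polynomial:
  assumes T: "T \<in> carrier_mat n n"
  obtains N :: int and Y b where "N \<noteq> 0" "Y \<in> carrier_mat n n"
    "\<And>X. X \<in> carrier_mat n n \<Longrightarrow> X * T = T * X \<Longrightarrow> X * Y = Y * X"
    "T ^\<^sub>m b * (N \<cdot>\<^sub>m 1\<^sub>m n - T ^\<^sub>m a * Y) = 0\<^sub>m n n"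
proof -
  obtain cs where cs: "horner n T cs = 0\<^sub>m n n" "\<exists>c\<in>set cs. c \<noteq> 0"
    using annihilating_horner[OF T] by blast
  obtain b c ds where c: "c \<noteq> 0" and b: "T ^\<^sub>m b * (c \<cdot>\<^sub>m 1\<^sub>m n + T * horner n T ds) = 0\<^sub>m n n"
    using horner_lowest_term[OF T cs(2)] cs(1) by metis
  define H where "H = horner n T ds"
  have H: "H \<in> carrier_mat n n" using T by (simp add: H_def)
  have HX: "X * H = H * X" if "X \<in> carrier_mat n n" "X * T = T * X" for X
    unfolding H_def by (rule horner_commute[OF T that])
  have TH: "T * H = H * T" by (rule HX[OF T refl])
  have Tb: "T ^\<^sub>m b \<in> carrier_mat n n" using T by simp
  have "c \<cdot>\<^sub>m T ^\<^sub>m b + T ^\<^sub>m b * (T * H) = 0\<^sub>m n n"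
    using b[folded H_def] T H by (simp add: mult_add_distrib_mat[of _ n n _ n] mult_smult_distrib[of _ n n _ n])
  then have "(c \<cdot>\<^sub>m T ^\<^sub>m b + T ^\<^sub>m b * (T * H)) $$ (r, s) = 0" if "r < n" "s < n" for r s
    using that by simp
  moreover have "(c \<cdot>\<^sub>m T ^\<^sub>m b + T ^\<^sub>m b * (T * H)) $$ (r, s)
      = c * (T ^\<^sub>m b) $$ (r, s) + (T ^\<^sub>m b * (T * H)) $$ (r, s)" if "r < n" "s < n" for r s
    using that T H Tb by (simp del: index_mult_mat(1))
  ultimately have "(T ^\<^sub>m b * (T * H)) $$ (r, s) = (- c) * (T ^\<^sub>m b) $$ (r, s)" if "r < n" "s < n" for r s
    using that by (metis add.inverse_unique mult_minus_left)
  \<comment> \<open>Multiplied by \<open>T ^\<^sub>m b\<close>, the factor \<open>T * H\<close> is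
    the scalar -c; since \<open>T\<close> and \<open>H\<close> commute, this can be
    iterated.\<close>
  then have step: "T ^\<^sub>m b * (T * H) = (- c) \<cdot>\<^sub>m T ^\<^sub>m b"
    using carrier_matD[OF T] carrier_matD[OF H] carrier_matD[OF Tb]
    by (intro eq_matI) (simp_all del: index_mult_mat(1) pow_mat_dim)
  have pow: "T ^\<^sub>m b * (T ^\<^sub>m k * H ^\<^sub>m k) = (- c) ^ k \<cdot>\<^sub>m T ^\<^sub>m b" for k
  proof (induction k)
    case 0
    show ?case using T H Tb by auto
  next
    case (Suc k)
    have Tk: "T ^\<^sub>m k \<in> carrier_mat n n" "H ^\<^sub>m k \<in> carrier_mat n n" using T H by auto
    have HTk: "H * T ^\<^sub>m k = T ^\<^sub>m k * H" by (rule pow_mat_commute[OF T H TH[symmetric]])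
    have TH': "T ^\<^sub>m k * H ^\<^sub>m k \<in> carrier_mat n n" "H * H ^\<^sub>m k \<in> carrier_mat n n" "T ^\<^sub>m k * H \<in> carrier_mat n n"
      using H Tk by (auto intro: mult_carrier_mat)
    have "T ^\<^sub>m Suc k * H ^\<^sub>m Suc k = T * (T ^\<^sub>m k * H) * H ^\<^sub>m k"
      using T H Tk TH' by (simp add: pow_mat_Suc_left[of _ n] assoc_mult_mat[of _ n n _ n _ n] del: pow_mat.simps)
    also have "\<dots> = T * H * (T ^\<^sub>m k * H ^\<^sub>m k)"
      unfolding HTk[symmetric] using T H Tk TH' by (simp add: assoc_mult_mat[of _ n n _ n _ n])
    finally have "T ^\<^sub>m b * (T ^\<^sub>m Suc k * H ^\<^sub>m Suc k) = T ^\<^sub>m b * (T * H) * (T ^\<^sub>m k * H ^\<^sub>m k)"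
      using T H Tk Tb TH' by (simp add: assoc_mult_mat[of _ n n _ n _ n] del: pow_mat.simps)
    also have "\<dots> = (- c) \<cdot>\<^sub>m (T ^\<^sub>m b * (T ^\<^sub>m k * H ^\<^sub>m k))"
      unfolding step using T H Tk Tb TH' by (simp add: mult_smult_assoc_mat[of _ n n _ n])
    also have "\<dots> = (- c) ^ Suc k \<cdot>\<^sub>m T ^\<^sub>m b" unfolding Suc by auto
    finally show ?case .
  qed
  show ?thesis
  \<comment> \<open>The exponent a stays free while b depends on \<open>T\<close> alone: the caller
    takes a beyond the exponent at which \<open>T\<close> dies on the unipotent quotient.\<close>
  proof (rule that[of "(- c) ^ a" "H ^\<^sub>m a" b])
    show "X * H ^\<^sub>m a = H ^\<^sub>m a * X" if "X \<in> carrier_mat n n" "X * T = T * X" for X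
      by (rule pow_mat_commute[OF H that(1) HX[OF that]])
    show "T ^\<^sub>m b * ((- c) ^ a \<cdot>\<^sub>m 1\<^sub>m n - T ^\<^sub>m a * H ^\<^sub>m a) = 0\<^sub>m n n"
      using T H Tb mult_carrier_mat[of "T ^\<^sub>m a" n n "H ^\<^sub>m a" n]
      by (simp add: mult_minus_distrib_mat[of _ n n _ n] mult_smult_distrib[of _ n n _ n] pow
          minus_r_inv_mat[of _ n n])
  qed (use c H in auto)
qed

section \<open>Affine actions as cocycles\<close>

abbreviation rmat :: "int mat \<Rightarrow> real mat" where
  "rmat \<equiv> map_mat real_of_int"

lemma rmat_mult_carrier [intro]:
  "B \<in> carrier_mat m n \<Longrightarrow> v \<in> carrier_vec n \<Longrightarrow> rmat B *\<^sub>v v \<in> carrier_vec m"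
  by (rule mult_mat_vec_carrier[of _ m n]) auto

lemma integer_lattice_iff:
  "v \<in> integer_lattice n \<longleftrightarrow> v \<in> carrier_vec n \<and> (\<forall>i<n. v $ i \<in> \<int>)"
proof
  assume v: "v \<in> carrier_vec n \<and> (\<forall>i<n. v $ i \<in> \<int>)"
  then have "v = map_vec real_of_int (map_vec floor v)"
    by (intro eq_vecI) (auto simp: of_int_floor_cancel)
  then show "v \<in> integer_lattice n"
    using v unfolding integer_lattice_def by (metis image_eqI map_carrier_vec)
qed (auto simp: integer_lattice_def)

text \<open>Equality of torus points in terms of representatives. The carrier conditions are built
  in, so that symmetry, transitivity and the arithmetic rules chain without side conditions.\<close>

definition torus_eq :: "nat \<Rightarrow> real vec \<Rightarrow> real vec \<Rightarrow> bool" where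
  "torus_eq n v w \<longleftrightarrow> v \<in> carrier_vec n \<and> w \<in> carrier_vec n \<and> v - w \<in> integer_lattice n"

lemma torus_eq_iff:
  "torus_eq n v w \<longleftrightarrow> v \<in> carrier_vec n \<and> w \<in> carrier_vec n \<and> (\<forall>i<n. v $ i - w $ i \<in> \<int>)"
  by (auto simp: torus_eq_def integer_lattice_iff)

lemma torus_eq_point:
  assumes "v \<in> carrier_vec n" "w \<in> carrier_vec n"
  shows "torus_point n v = torus_point n w \<longleftrightarrow> torus_eq n v w"
  using assms torus_point_eq_iff by (simp add: torus_eq_def)

lemma torus_eq_carrier: "torus_eq n v w \<Longrightarrow> v \<in> carrier_vec n" "torus_eq n v w \<Longrightarrow> w \<in> carrier_vec n"
  by (auto simp: torus_eq_def)

lemma torus_eq_refl: "v \<in> carrier_vec n \<Longrightarrow> torus_eq n v v"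
  by (auto simp: torus_eq_iff)

lemma torus_eq_sym: "torus_eq n v w \<Longrightarrow> torus_eq n w v"
  unfolding torus_eq_iff by (metis Ints_minus minus_diff_eq)

lemma torus_eq_trans [trans]:
  assumes "torus_eq n u v" "torus_eq n v w"
  shows "torus_eq n u w"
proof -
  have "u $ i - w $ i = (u $ i - v $ i) + (v $ i - w $ i)" for i by simp
  then show ?thesis using assms unfolding torus_eq_iff by (metis Ints_add)
qed

lemma torus_eq_add:
  assumes "torus_eq n u v" "torus_eq n u' v'"
  shows "torus_eq n (u + u') (v + v')"
proof -
  have "(u $ i + u' $ i) - (v $ i + v' $ i) \<in> \<int>" if "i < n" for i
    using Ints_add[of "u $ i - v $ i" "u' $ i - v' $ i"] assms that by (simp add: torus_eq_iff algebra_simps)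
  then show ?thesis using assms unfolding torus_eq_iff by auto
qed

lemma torus_eq_diff:
  assumes "torus_eq n u v" "torus_eq n u' v'"
  shows "torus_eq n (u - u') (v - v')"
proof -
  have "(u $ i - u' $ i) - (v $ i - v' $ i) \<in> \<int>" if "i < n" for i
    using Ints_diff[of "u $ i - v $ i" "u' $ i - v' $ i"] assms that by (simp add: torus_eq_iff algebra_simps)
  then show ?thesis using assms unfolding torus_eq_iff by auto
qed

lemma torus_eq_smult:
  assumes "torus_eq n u v"
  shows "torus_eq n (real_of_int k \<cdot>\<^sub>v u) (real_of_int k \<cdot>\<^sub>v v)"
  using assms unfolding torus_eq_iff by (auto simp: right_diff_distrib[symmetric])

lemma torus_eq_mult:
  assumes M: "M \<in> carrier_mat m n" and uv: "torus_eq n u v"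
  shows "torus_eq m (rmat M *\<^sub>v u) (rmat M *\<^sub>v v)"
proof -
  obtain z where z: "z \<in> carrier_vec n" "u - v = map_vec real_of_int z"
    using uv by (auto simp: torus_eq_def integer_lattice_def)
  have "rmat M *\<^sub>v u - rmat M *\<^sub>v v = rmat M *\<^sub>v (u - v)"
    using M uv by (subst mult_minus_distrib_mat_vec[of _ m n]) (auto simp: torus_eq_def)
  also have "\<dots> = map_vec real_of_int (M *\<^sub>v z)"
    unfolding z(2) by (rule of_int_hom.mult_mat_vec_hom[OF M z(1), symmetric])
  finally show ?thesis
    using M uv z by (auto simp: torus_eq_def integer_lattice_def)
qed

text \<open>A crossed homomorphism from \<int>^p to the torus. Its values are real representatives,
  so the cocycle identity holds only modulo the lattice.\<close>

definition torus_cocycle :: "nat \<Rightarrow> nat \<Rightarrow> (int vec \<Rightarrow> int mat) \<Rightarrow> (int vec \<Rightarrow> real vec) \<Rightarrow> bool" where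
  "torus_cocycle p q A t \<longleftrightarrow>
     (\<forall>l \<in> carrier_vec p. t l \<in> carrier_vec q) \<and>
     (\<forall>l \<in> carrier_vec p. \<forall>l' \<in> carrier_vec p. torus_eq q (t (l + l')) (rmat (A l) *\<^sub>v t l' + t l))"

lemma lattice_actionD:
  assumes "lattice_action p q A"
  shows lattice_action_GLZ: "l \<in> carrier_vec p \<Longrightarrow> A l \<in> carrier (GLZ q)"
    and lattice_action_carrier: "l \<in> carrier_vec p \<Longrightarrow> A l \<in> carrier_mat q q"
    and lattice_action_add: "l \<in> carrier_vec p \<Longrightarrow> l' \<in> carrier_vec p \<Longrightarrow> A (l + l') = A l * A l'"
  using assms unfolding lattice_action_def hom_def
  by (auto simp: monoid_vec_simps mult_GLZ carrier_GLZ Pi_iff)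

text \<open>Once the linear part is prescribed, an affine action is a choice of one translation for
  each \<open>l\<close>, and composition of affine maps turns the homomorphism law into the cocycle
  identity. From here on cosets are replaced by representatives.\<close>

lemma liberated_affine_iff:
  assumes A: "lattice_action p q A"
  shows "liberated_affine p q A \<longleftrightarrow>
    (\<exists>t. torus_cocycle p q A t \<and>
      (\<forall>l \<in> carrier_vec p - {0\<^sub>v p}. \<forall>x \<in> carrier_vec q. \<not> torus_eq q (rmat (A l) *\<^sub>v x + t l) x))"
    (is "_ \<longleftrightarrow> ?R")
proof
  have Ac: "A l \<in> carrier_mat q q" and AG: "A l \<in> carrier (GLZ q)" if "l \<in> carrier_vec p" for l
    using lattice_actionD[OF A] that by auto
  {
    assume "liberated_affine p q A"
    then obtain \<phi> where \<phi>: "\<phi> \<in> hom (Zpow p) (affine_group q)" "free_action p q \<phi>"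
      and lin: "\<And>l. l \<in> carrier_vec p \<Longrightarrow> linear_part q (\<phi> l) = A l"
      by (auto simp: liberated_affine_def affine_action_def monoid_vec_simps)
    have "\<exists>v. v \<in> carrier_vec q \<and> \<phi> l = affine_map q (A l) (torus_point q v)" if l: "l \<in> carrier_vec p" for l
    proof -
      have "\<phi> l \<in> carrier (affine_group q)"
        using \<phi>(1) l by (auto simp: hom_def monoid_vec_simps)
      then obtain B a where B: "B \<in> carrier (GLZ q)" "a \<in> carrier (torus q)" "\<phi> l = affine_map q B a"
        by (auto simp: affine_group_def)
      moreover have "B = A l" using linear_part_affine_map[OF B(1,2)] lin[OF l] B(3) by simp
      ultimately show ?thesis by (auto simp: carrier_torus)
    qed
    then obtain t where t: "\<And>l. l \<in> carrier_vec p \<Longrightarrow> t l \<in> carrier_vec q"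
      and \<phi>t: "\<And>l. l \<in> carrier_vec p \<Longrightarrow> \<phi> l = affine_map q (A l) (torus_point q (t l))"
      by metis
    have "torus_eq q (t (l + l')) (rmat (A l) *\<^sub>v t l' + t l)"
      if l: "l \<in> carrier_vec p" and l': "l' \<in> carrier_vec p" for l l'
    proof -
      have ll: "l + l' \<in> carrier_vec p" using l l' by simp
      have c: "rmat (A l) *\<^sub>v t l' + t l \<in> carrier_vec q" using Ac t l l' by (intro add_carrier_vec rmat_mult_carrier[of _ q q]) auto
      have "\<phi> (l + l') = compose (carrier (torus q)) (\<phi> l) (\<phi> l')"
        using \<phi>(1) l l' by (auto simp: hom_def monoid_vec_simps affine_group_def)
      then have "affine_map q (A (l + l')) (torus_point q (t (l + l')))
          = affine_map q (A (l + l')) (torus_point q (rmat (A l) *\<^sub>v t l' + t l))"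
        using compose_affine_map[OF AG[OF l] AG[OF l'] t[OF l] t[OF l']] \<phi>t ll l l'
        by (simp add: lattice_action_add[OF A])
      \<comment> \<open>Evaluating both affine maps at the zero of the torus compares their
        translations.\<close>
      then have "torus_point q (rmat (A (l + l')) *\<^sub>v 0\<^sub>v q + t (l + l'))
          = torus_point q (rmat (A (l + l')) *\<^sub>v 0\<^sub>v q + (rmat (A l) *\<^sub>v t l' + t l))"
        using affine_map_coset[OF AG[OF ll] zero_carrier_vec] t[OF ll] c by metis
      moreover have "rmat (A (l + l')) *\<^sub>v 0\<^sub>v q = 0\<^sub>v q" using Ac[OF ll] by auto
      ultimately show ?thesis using torus_eq_point t[OF ll] c by simp
    qed
    then have "torus_cocycle p q A t" using t by (auto simp: torus_cocycle_def)
    moreover have "\<not> torus_eq q (rmat (A l) *\<^sub>v x + t l) x"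
      if l: "l \<in> carrier_vec p - {0\<^sub>v p}" and x: "x \<in> carrier_vec q" for l x
    proof
      assume eq: "torus_eq q (rmat (A l) *\<^sub>v x + t l) x"
      have "\<phi> l (torus_point q x) = torus_point q (rmat (A l) *\<^sub>v x + t l)"
        using l x t \<phi>t by (simp add: affine_map_coset[OF AG])
      also have "\<dots> = torus_point q x" using torus_eq_point eq torus_eq_carrier by metis
      finally show False
        using \<phi>(2) l torus_point_closed[OF x] by (auto simp: free_action_def monoid_vec_simps)
    qed
    ultimately show ?R by blast
  }
  assume ?R
  then obtain t where t: "torus_cocycle p q A t"
    and free: "\<And>l x. l \<in> carrier_vec p - {0\<^sub>v p} \<Longrightarrow> x \<in> carrier_vec q \<Longrightarrow>
      \<not> torus_eq q (rmat (A l) *\<^sub>v x + t l) x" by blast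
  have tc: "t l \<in> carrier_vec q" if "l \<in> carrier_vec p" for l
    using t that by (auto simp: torus_cocycle_def)
  define \<phi> where "\<phi> l = affine_map q (A l) (torus_point q (t l))" for l
  have "\<phi> \<in> hom (Zpow p) (affine_group q)"
  proof (rule homI)
    fix l assume "l \<in> carrier (Zpow p)"
    then have l: "l \<in> carrier_vec p" by (simp add: monoid_vec_simps)
    show "\<phi> l \<in> carrier (affine_group q)"
      using AG[OF l] torus_point_closed[OF tc[OF l]] by (auto simp: affine_group_def \<phi>_def)
    fix l' assume "l' \<in> carrier (Zpow p)"
    then have l': "l' \<in> carrier_vec p" by (simp add: monoid_vec_simps)
    have "torus_eq q (t (l + l')) (rmat (A l) *\<^sub>v t l' + t l)"
      using t l l' by (auto simp: torus_cocycle_def)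
    then have "torus_point q (t (l + l')) = torus_point q (rmat (A l) *\<^sub>v t l' + t l)"
      using torus_eq_point torus_eq_carrier by metis
    then show "\<phi> (l \<otimes>\<^bsub>Zpow p\<^esub> l') = \<phi> l \<otimes>\<^bsub>affine_group q\<^esub> \<phi> l'"
      using compose_affine_map[OF AG[OF l] AG[OF l'] tc[OF l] tc[OF l']] lattice_action_add[OF A l l']
      by (simp add: \<phi>_def monoid_vec_simps affine_group_def)
  qed
  moreover have "free_action p q \<phi>"
    unfolding free_action_def
  proof (intro ballI notI)
    fix l X assume l: "l \<in> carrier (Zpow p) - {0\<^sub>v p}" and X: "X \<in> carrier (torus q)" and eq: "\<phi> l X = X"
    then obtain x where x: "x \<in> carrier_vec q" "X = torus_point q x" by (auto simp: carrier_torus)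
    have l': "l \<in> carrier_vec p" using l by (simp add: monoid_vec_simps)
    have "torus_point q (rmat (A l) *\<^sub>v x + t l) = torus_point q x"
      using eq affine_map_coset[OF AG[OF l'] x(1) tc[OF l']] by (simp add: \<phi>_def x(2))
    then have "torus_eq q (rmat (A l) *\<^sub>v x + t l) x"
      using torus_eq_point[of "rmat (A l) *\<^sub>v x + t l" q x] Ac[OF l'] tc[OF l'] x(1) by auto
    then show False using free[of l x] l x by (simp add: monoid_vec_simps)
  qed
  moreover have "linear_part q (\<phi> l) = A l" if "l \<in> carrier_vec p" for l
    unfolding \<phi>_def by (rule linear_part_affine_map[OF AG torus_point_closed[OF tc]]) (use that in auto)
  ultimately show "liberated_affine p q A"
    by (auto simp: liberated_affine_def affine_action_def monoid_vec_simps)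
qed

section \<open>Arithmetic of integer matrices acting on real vectors\<close>

lemma rmat_mult_vec:
  assumes "B \<in> carrier_mat a b" "C \<in> carrier_mat b c" "v \<in> carrier_vec c"
  shows "rmat (B * C) *\<^sub>v v = rmat B *\<^sub>v (rmat C *\<^sub>v v)"
proof -
  have "rmat (B * C) = rmat B * rmat C" by (rule of_int_hom.mat_hom_mult[OF assms(1,2)])
  then show ?thesis using assms by (simp add: assoc_mult_mat_vec[of _ a b _ c])
qed

lemma rmat_add_vec:
  assumes "B \<in> carrier_mat a b" "v \<in> carrier_vec b" "w \<in> carrier_vec b"
  shows "rmat B *\<^sub>v (v + w) = rmat B *\<^sub>v v + rmat B *\<^sub>v w"
  using assms by (intro mult_add_distrib_mat_vec[of _ a b]) auto

lemma rmat_diff_vec: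
  assumes "B \<in> carrier_mat a b" "v \<in> carrier_vec b" "w \<in> carrier_vec b"
  shows "rmat B *\<^sub>v (v - w) = rmat B *\<^sub>v v - rmat B *\<^sub>v w"
  using assms by (intro mult_minus_distrib_mat_vec[of _ a b]) auto

lemma rmat_smult_vec:
  assumes "B \<in> carrier_mat a b" "v \<in> carrier_vec b"
  shows "rmat B *\<^sub>v (k \<cdot>\<^sub>v v) = k \<cdot>\<^sub>v (rmat B *\<^sub>v v)"
  using assms by (intro mult_mat_vec[of _ a b]) auto

lemma rmat_diff_mult_vec:
  assumes "B \<in> carrier_mat a b" "C \<in> carrier_mat a b" "v \<in> carrier_vec b"
  shows "rmat (B - C) *\<^sub>v v = rmat B *\<^sub>v v - rmat C *\<^sub>v v"
proof -
  have "rmat (B - C) = rmat B - rmat C" using assms by (intro eq_matI) auto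
  then show ?thesis using assms by (simp add: minus_mult_distrib_mat_vec[of _ a b])
qed

lemma rmat_add_mult_vec:
  assumes "B \<in> carrier_mat a b" "C \<in> carrier_mat a b" "v \<in> carrier_vec b"
  shows "rmat (B + C) *\<^sub>v v = rmat B *\<^sub>v v + rmat C *\<^sub>v v"
proof -
  have "rmat (B + C) = rmat B + rmat C" using assms by (intro eq_matI) auto
  then show ?thesis using assms by (simp add: add_mult_distrib_mat_vec[of _ a b])
qed

lemma rmat_smult_one_vec:
  assumes "v \<in> carrier_vec n"
  shows "rmat (c \<cdot>\<^sub>m 1\<^sub>m n) *\<^sub>v v = real_of_int c \<cdot>\<^sub>v v"
proof -
  have "rmat (c \<cdot>\<^sub>m 1\<^sub>m n) = real_of_int c \<cdot>\<^sub>m 1\<^sub>m n" by (intro eq_matI) auto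
  moreover have "(real_of_int c \<cdot>\<^sub>m 1\<^sub>m n) *\<^sub>v v = real_of_int c \<cdot>\<^sub>v (1\<^sub>m n *\<^sub>v v)"
    using assms by (intro eq_vecI) auto
  ultimately show ?thesis using assms by simp
qed

lemma rmat_one_vec: "v \<in> carrier_vec n \<Longrightarrow> rmat (1\<^sub>m n) *\<^sub>v v = v"
  by (simp add: of_int_hom.mat_hom_one)

lemma rmat_zero_vec: "v \<in> carrier_vec b \<Longrightarrow> rmat (0\<^sub>m a b) *\<^sub>v v = 0\<^sub>v a"
  by (intro eq_vecI) (auto simp: scalar_prod_def)

lemma zero_mat_mult_vec: "(v :: int vec) \<in> carrier_vec b \<Longrightarrow> 0\<^sub>m a b *\<^sub>v v = 0\<^sub>v a"
  by (intro eq_vecI) (auto simp: scalar_prod_def)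

lemma lattice_action_zero:
  assumes A: "lattice_action p q A"
  shows "A (0\<^sub>v p) = 1\<^sub>m q"
proof -
  let ?Z = "A (0\<^sub>v p)"
  have Z: "?Z \<in> carrier (GLZ q)" by (rule lattice_action_GLZ[OF A]) simp
  have "?Z * ?Z = ?Z"
    using lattice_action_add[OF A, of "0\<^sub>v p" "0\<^sub>v p"] by simp
  obtain C where C: "C \<in> carrier_mat q q" "C * ?Z = 1\<^sub>m q" and Zc: "?Z \<in> carrier_mat q q"
    using Z by (auto simp: carrier_GLZ)
  have "C * (?Z * ?Z) = ?Z" using C Zc by (simp add: assoc_mult_mat[of _ q q _ q _ q, symmetric])
  then show ?thesis using \<open>?Z * ?Z = ?Z\<close> C by simp
qed

section \<open>Cocycles along the multiples of one lattice vector\<close>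

lemma torus_cocycleD:
  assumes "torus_cocycle p q A t"
  shows torus_cocycle_carrier: "l \<in> carrier_vec p \<Longrightarrow> t l \<in> carrier_vec q"
    and torus_cocycle_add: "l \<in> carrier_vec p \<Longrightarrow> l' \<in> carrier_vec p \<Longrightarrow>
      torus_eq q (t (l + l')) (rmat (A l) *\<^sub>v t l' + t l)"
  using assms by (auto simp: torus_cocycle_def)

lemma torus_cocycle_zero:
  assumes A: "lattice_action p q A" and t: "torus_cocycle p q A t"
  shows "torus_eq q (t (0\<^sub>v p)) (0\<^sub>v q)"
proof -
  have tc: "t (0\<^sub>v p) \<in> carrier_vec q" by (rule torus_cocycle_carrier[OF t]) simp
  have "torus_eq q (t (0\<^sub>v p)) (t (0\<^sub>v p) + t (0\<^sub>v p))"
    using torus_cocycle_add[OF t, of "0\<^sub>v p" "0\<^sub>v p"] tc by (simp add: lattice_action_zero[OF A] rmat_one_vec)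
  from torus_eq_diff[OF torus_eq_sym[OF this] torus_eq_refl[OF tc]]
  have "torus_eq q (t (0\<^sub>v p) + t (0\<^sub>v p) - t (0\<^sub>v p)) (0\<^sub>v q)" using tc by simp
  moreover have "t (0\<^sub>v p) + t (0\<^sub>v p) - t (0\<^sub>v p) = t (0\<^sub>v p)" using tc by (intro eq_vecI) auto
  ultimately show ?thesis by simp
qed

text \<open>The sum 1 + B + ... + B^(k-1) in Horner form. With B = \<open>A l\<close> it carries
  \<open>t l\<close> to \<open>t (k l)\<close>, see \<open>torus_cocycle_smult\<close>.\<close>

fun geometric_mat :: "nat \<Rightarrow> int mat \<Rightarrow> nat \<Rightarrow> int mat" where
  "geometric_mat n B 0 = 0\<^sub>m n n"
| "geometric_mat n B (Suc k) = 1\<^sub>m n + B * geometric_mat n B k"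

lemma geometric_mat_carrier [simp]: "B \<in> carrier_mat n n \<Longrightarrow> geometric_mat n B k \<in> carrier_mat n n"
  by (induction k) auto

lemma geometric_mat_Suc_vec:
  assumes B: "B \<in> carrier_mat n n" and v: "v \<in> carrier_vec n"
  shows "geometric_mat n B (Suc k) *\<^sub>v v = v + B *\<^sub>v (geometric_mat n B k *\<^sub>v v)"
  using assms geometric_mat_carrier[OF B, of k]
  by (simp add: add_mult_distrib_mat_vec[of _ n n] assoc_mult_mat_vec[of _ n n _ n])

lemma rmat_geometric_mat_Suc_vec:
  assumes B: "B \<in> carrier_mat n n" and v: "v \<in> carrier_vec n"
  shows "rmat (geometric_mat n B (Suc k)) *\<^sub>v v = v + rmat B *\<^sub>v (rmat (geometric_mat n B k) *\<^sub>v v)"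
  using assms geometric_mat_carrier[OF B, of k]
  by (simp add: rmat_add_mult_vec[of _ n n] rmat_mult_vec[of _ n n _ n] rmat_one_vec)

lemma smult_Suc_int_vec: "l \<in> carrier_vec p \<Longrightarrow> int (Suc k) \<cdot>\<^sub>v l = l + int k \<cdot>\<^sub>v l"
  by (intro eq_vecI) (auto simp: algebra_simps)

lemma lattice_action_smult_Suc:
  assumes "lattice_action p q A" "l \<in> carrier_vec p"
  shows "A (int (Suc k) \<cdot>\<^sub>v l) = A l * A (int k \<cdot>\<^sub>v l)"
  using assms by (simp only: smult_Suc_int_vec) (simp add: lattice_action_add)

text \<open>For the pigeonhole argument: two partial sums differ by an invertible matrix applied to
  another partial sum. The power B^j is written as \<open>A\<close> at j l, which makes its integral
  inverse available as \<open>A\<close> at -j l.\<close>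

lemma geometric_mat_add_vec:
  assumes A: "lattice_action p q A" and l: "l \<in> carrier_vec p" and u: "u \<in> carrier_vec q"
  shows "geometric_mat q (A l) (j + k) *\<^sub>v u =
    geometric_mat q (A l) j *\<^sub>v u + A (int j \<cdot>\<^sub>v l) *\<^sub>v (geometric_mat q (A l) k *\<^sub>v u)"
proof (induction j)
  case 0
  have "int 0 \<cdot>\<^sub>v l = 0\<^sub>v p" using l by (intro eq_vecI) auto
  moreover have "geometric_mat q (A l) k *\<^sub>v u \<in> carrier_vec q"
    using geometric_mat_carrier[OF lattice_action_carrier[OF A l]] u by (rule mult_mat_vec_carrier)
  ultimately show ?case using u by (simp add: lattice_action_zero[OF A] zero_mat_mult_vec)
next
  case (Suc j)
  have B: "A l \<in> carrier_mat q q" and C: "A (int j \<cdot>\<^sub>v l) \<in> carrier_mat q q"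
    using l by (auto intro: lattice_action_carrier[OF A])
  have S: "geometric_mat q (A l) i *\<^sub>v u \<in> carrier_vec q" for i
    using geometric_mat_carrier[OF B] u by (rule mult_mat_vec_carrier)
  have CS: "A (int j \<cdot>\<^sub>v l) *\<^sub>v (geometric_mat q (A l) k *\<^sub>v u) \<in> carrier_vec q"
    using C S by (rule mult_mat_vec_carrier)
  have "geometric_mat q (A l) (Suc j + k) *\<^sub>v u = u + A l *\<^sub>v (geometric_mat q (A l) (j + k) *\<^sub>v u)"
    using geometric_mat_Suc_vec[OF B u] by simp
  also have "\<dots> = u + (A l *\<^sub>v (geometric_mat q (A l) j *\<^sub>v u)
      + A l *\<^sub>v (A (int j \<cdot>\<^sub>v l) *\<^sub>v (geometric_mat q (A l) k *\<^sub>v u)))"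
    unfolding Suc by (subst mult_add_distrib_mat_vec[OF B S CS]) simp
  also have "\<dots> = (u + A l *\<^sub>v (geometric_mat q (A l) j *\<^sub>v u))
      + A l *\<^sub>v (A (int j \<cdot>\<^sub>v l) *\<^sub>v (geometric_mat q (A l) k *\<^sub>v u))"
    by (rule assoc_add_vec[of _ q, symmetric]) (use u B S CS in \<open>auto intro: mult_mat_vec_carrier\<close>)
  also have "A l *\<^sub>v (A (int j \<cdot>\<^sub>v l) *\<^sub>v (geometric_mat q (A l) k *\<^sub>v u))
      = A (int (Suc j) \<cdot>\<^sub>v l) *\<^sub>v (geometric_mat q (A l) k *\<^sub>v u)"
    unfolding lattice_action_smult_Suc[OF A l] by (rule assoc_mult_mat_vec[OF B C S, symmetric])
  finally show ?case using geometric_mat_Suc_vec[OF B u] by simp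
qed

text \<open>Telescoping of (1 + B + ... + B^(k-1)) (B - 1) = B^k - 1: a coboundary at
  \<open>l\<close> becomes a coboundary at k l with the same vector w.\<close>

lemma rmat_geometric_mat_diff:
  assumes A: "lattice_action p q A" and l: "l \<in> carrier_vec p" and w: "w \<in> carrier_vec q"
  shows "rmat (geometric_mat q (A l) k) *\<^sub>v (rmat (A l) *\<^sub>v w - w) = rmat (A (int k \<cdot>\<^sub>v l)) *\<^sub>v w - w"
proof (induction k)
  case 0
  have "int 0 \<cdot>\<^sub>v l = 0\<^sub>v p" using l by (intro eq_vecI) auto
  moreover have "rmat (0\<^sub>m q q) *\<^sub>v (rmat (A l) *\<^sub>v w - w) = 0\<^sub>v q" using w
    by (intro rmat_zero_vec minus_carrier_vec rmat_mult_carrier[OF lattice_action_carrier[OF A l]])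
  ultimately show ?case using w by (simp add: lattice_action_zero[OF A] rmat_one_vec)
next
  case (Suc k)
  have B: "A l \<in> carrier_mat q q" and C: "A (int k \<cdot>\<^sub>v l) \<in> carrier_mat q q"
    using l by (auto intro: lattice_action_carrier[OF A])
  have Cw: "rmat (A (int k \<cdot>\<^sub>v l)) *\<^sub>v w \<in> carrier_vec q" and Bw: "rmat (A l) *\<^sub>v w \<in> carrier_vec q"
    and BCw: "rmat (A l) *\<^sub>v (rmat (A (int k \<cdot>\<^sub>v l)) *\<^sub>v w) \<in> carrier_vec q"
    using B C w by (auto intro!: rmat_mult_carrier)
  have "rmat (geometric_mat q (A l) (Suc k)) *\<^sub>v (rmat (A l) *\<^sub>v w - w)
      = (rmat (A l) *\<^sub>v w - w) + rmat (A l) *\<^sub>v (rmat (A (int k \<cdot>\<^sub>v l)) *\<^sub>v w - w)"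
    using rmat_geometric_mat_Suc_vec[OF B, of "rmat (A l) *\<^sub>v w - w" k] Bw w Suc by simp
  also have "\<dots> = (rmat (A l) *\<^sub>v w - w) + (rmat (A l) *\<^sub>v (rmat (A (int k \<cdot>\<^sub>v l)) *\<^sub>v w) - rmat (A l) *\<^sub>v w)"
    unfolding rmat_diff_vec[OF B Cw w] ..
  also have "\<dots> = rmat (A l) *\<^sub>v (rmat (A (int k \<cdot>\<^sub>v l)) *\<^sub>v w) - w"
    using carrier_vecD[OF Bw] carrier_vecD[OF BCw] w
    by (intro eq_vecI) (simp_all del: index_mult_mat_vec dim_mult_mat_vec)
  finally show ?case unfolding lattice_action_smult_Suc[OF A l] rmat_mult_vec[OF B C w] .
qed

lemma torus_cocycle_smult:
  assumes A: "lattice_action p q A" and t: "torus_cocycle p q A t" and l: "l \<in> carrier_vec p"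
  shows "torus_eq q (t (int k \<cdot>\<^sub>v l)) (rmat (geometric_mat q (A l) k) *\<^sub>v t l)"
proof (induction k)
  case 0
  have "int 0 \<cdot>\<^sub>v l = 0\<^sub>v p" using l by (intro eq_vecI) auto
  moreover have "rmat (0\<^sub>m q q) *\<^sub>v t l = 0\<^sub>v q"
    using torus_cocycle_carrier[OF t l] by (rule rmat_zero_vec)
  ultimately show ?case using torus_cocycle_zero[OF A t] by simp
next
  case (Suc k)
  have B: "A l \<in> carrier_mat q q" by (rule lattice_action_carrier[OF A l])
  have tl: "t l \<in> carrier_vec q" by (rule torus_cocycle_carrier[OF t l])
  have "torus_eq q (t (int (Suc k) \<cdot>\<^sub>v l)) (rmat (A l) *\<^sub>v t (int k \<cdot>\<^sub>v l) + t l)"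
    unfolding smult_Suc_int_vec[OF l] by (rule torus_cocycle_add[OF t l]) (use l in simp)
  also have "torus_eq q \<dots> (rmat (A l) *\<^sub>v (rmat (geometric_mat q (A l) k) *\<^sub>v t l) + t l)"
    by (rule torus_eq_add[OF torus_eq_mult[OF B Suc] torus_eq_refl[OF tl]])
  also have "\<dots> = rmat (geometric_mat q (A l) (Suc k)) *\<^sub>v t l"
    unfolding rmat_geometric_mat_Suc_vec[OF B tl]
    by (rule comm_add_vec[of _ q]) (use B tl in \<open>auto intro!: rmat_mult_carrier\<close>)
  finally show ?case .
qed

text \<open>Pigeonhole on the partial sums \<open>\<Sum>i<k. B\<^sup>i u\<close> modulo \<open>M\<close>, with \<open>B = A l\<close> invertible.\<close>

lemma geometric_mat_dvd:
  assumes A: "lattice_action p q A" and l: "l \<in> carrier_vec p" and u: "u \<in> carrier_vec q" and M: "M \<noteq> 0"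
  obtains k y where "k \<ge> 1" "y \<in> carrier_vec q" "geometric_mat q (A l) k *\<^sub>v u = M \<cdot>\<^sub>v y"
proof -
  let ?S = "geometric_mat q (A l)"
  define f where "f k = map (\<lambda>i. (?S k *\<^sub>v u) $ i mod M) [0..<q]" for k
  have S: "?S i *\<^sub>v u \<in> carrier_vec q" for i
    using geometric_mat_carrier[OF lattice_action_carrier[OF A l]] u by (rule mult_mat_vec_carrier)
  have "range f \<subseteq> {xs. set xs \<subseteq> {- \<bar>M\<bar>..\<bar>M\<bar>} \<and> length xs = q}"
  proof -
    \<comment> \<open>M may have either sign, hence the symmetric interval for the residues.\<close>
    have "z mod M \<in> {- \<bar>M\<bar>..\<bar>M\<bar>}" for z
      using abs_mod_less[OF M, of z] by auto
    then show ?thesis by (auto simp: f_def)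
  qed
  then have "finite (range f)"
    using finite_lists_length_eq[of "{- \<bar>M\<bar>..\<bar>M\<bar>}" q] finite_subset by blast
  then have "\<not> inj f" using finite_imageD[of f UNIV] by auto
  then obtain j i where "f j = f i" "j < i" unfolding inj_def by (metis linorder_neqE_nat)
  then obtain k where k: "k \<ge> 1" "f (j + k) = f j"
    by (metis less_imp_add_positive One_nat_def Suc_leI)
  \<comment> \<open>The coincidence of residues makes M divide the entries of C applied to the k-th
    partial sum. The inverse \<open>?D\<close> of \<open>?C\<close> is integral, so it passes the
    divisibility on to the partial sum itself.\<close>
  let ?C = "A (int j \<cdot>\<^sub>v l)" and ?D = "A (- (int j \<cdot>\<^sub>v l))"
  have C: "?C \<in> carrier_mat q q" and D: "?D \<in> carrier_mat q q"
    using l by (auto intro!: lattice_action_carrier[OF A])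
  have CS: "?C *\<^sub>v (?S k *\<^sub>v u) \<in> carrier_vec q" using C S by (rule mult_mat_vec_carrier)
  define y where "y = vec q (\<lambda>i. (?C *\<^sub>v (?S k *\<^sub>v u)) $ i div M)"
  have y: "y \<in> carrier_vec q" by (simp add: y_def)
  have "M dvd (?C *\<^sub>v (?S k *\<^sub>v u)) $ i" if "i < q" for i
  proof -
    have "f (j + k) ! i = f j ! i" using k(2) by simp
    then have "(?S (j + k) *\<^sub>v u) $ i mod M = (?S j *\<^sub>v u) $ i mod M" using that by (simp add: f_def)
    then have "M dvd (?S (j + k) *\<^sub>v u) $ i - (?S j *\<^sub>v u) $ i" by (simp only: mod_eq_dvd_iff)
    then show ?thesis
      unfolding geometric_mat_add_vec[OF A l u]
      using that carrier_vecD[OF S] carrier_vecD[OF CS] by (simp del: index_mult_mat_vec dim_mult_mat_vec)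
  qed
  then have "?C *\<^sub>v (?S k *\<^sub>v u) = M \<cdot>\<^sub>v y"
    using carrier_vecD[OF CS] by (intro eq_vecI) (simp_all add: y_def del: index_mult_mat_vec dim_mult_mat_vec)
  moreover have "?D *\<^sub>v (M \<cdot>\<^sub>v y) = M \<cdot>\<^sub>v (?D *\<^sub>v y)"
    using D y by (intro eq_vecI) auto
  ultimately have "?D *\<^sub>v (?C *\<^sub>v (?S k *\<^sub>v u)) = M \<cdot>\<^sub>v (?D *\<^sub>v y)"
    by simp
  moreover have "?D * ?C = 1\<^sub>m q"
  proof -
    have "- (int j \<cdot>\<^sub>v l) + int j \<cdot>\<^sub>v l = 0\<^sub>v p" using l by (intro uminus_l_inv_vec) simp
    then show ?thesis
      using l lattice_action_add[OF A, of "- (int j \<cdot>\<^sub>v l)" "int j \<cdot>\<^sub>v l"] by (simp add: lattice_action_zero[OF A])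
  qed
  ultimately have "?S k *\<^sub>v u = M \<cdot>\<^sub>v (?D *\<^sub>v y)"
    using assoc_mult_mat_vec[OF D C S[of k]] S[of k] by (metis one_mult_mat_vec)
  with k(1) show ?thesis using that D y by (meson mult_mat_vec_carrier)
qed

text \<open>Write M t(l) = (A(l) - 1) w + u with u integral. Dividing by M at once would leave the
  error u / M. Applying the k-th geometric sum first, with k such that M divides its value at u,
  makes the error integral: modulo the lattice, t(k l) is (A(k l) - 1) (w / M).\<close>

lemma fixed_point_of_multiple:
  assumes A: "lattice_action p q A" and t: "torus_cocycle p q A t" and l: "l \<in> carrier_vec p"
    and w: "w \<in> carrier_vec q" and M: "M \<noteq> 0"
    and eq: "torus_eq q (real_of_int M \<cdot>\<^sub>v t l) (rmat (A l) *\<^sub>v w - w)"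
  obtains k x where "k \<ge> 1" "x \<in> carrier_vec q"
    "torus_eq q (rmat (A (int k \<cdot>\<^sub>v l)) *\<^sub>v x + t (int k \<cdot>\<^sub>v l)) x"
proof -
  have tl: "t l \<in> carrier_vec q" by (rule torus_cocycle_carrier[OF t l])
  have B: "A l \<in> carrier_mat q q" by (rule lattice_action_carrier[OF A l])
  have Bw: "rmat (A l) *\<^sub>v w - w \<in> carrier_vec q" using eq by (simp add: torus_eq_def)
  obtain u where u: "u \<in> carrier_vec q"
    "real_of_int M \<cdot>\<^sub>v t l - (rmat (A l) *\<^sub>v w - w) = map_vec real_of_int u"
    using eq by (auto simp: torus_eq_def integer_lattice_def)
  have "(real_of_int M \<cdot>\<^sub>v t l) $ i = ((rmat (A l) *\<^sub>v w - w) + map_vec real_of_int u) $ i" if "i < q" for i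
  proof -
    have "(real_of_int M \<cdot>\<^sub>v t l) $ i - (rmat (A l) *\<^sub>v w - w) $ i = real_of_int (u $ i)"
      using arg_cong[OF u(2), of "\<lambda>v. v $ i"] that carrier_vecD[OF Bw] tl u(1)
      by (simp del: index_mult_mat_vec index_minus_vec(2) add: index_minus_vec(1)[of i "rmat (A l) *\<^sub>v w - w" "real_of_int M \<cdot>\<^sub>v t l"])
    then show ?thesis
      using that u(1) by (simp del: index_mult_mat_vec index_minus_vec)
  qed
  then have Mt: "real_of_int M \<cdot>\<^sub>v t l = (rmat (A l) *\<^sub>v w - w) + map_vec real_of_int u"
    using tl u(1) carrier_vecD[OF Bw] by (intro eq_vecI) (simp_all del: index_minus_vec)
  obtain k y where k: "k \<ge> 1" and y: "y \<in> carrier_vec q" "geometric_mat q (A l) k *\<^sub>v u = M \<cdot>\<^sub>v y"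
    using geometric_mat_dvd[OF A l u(1) M] by blast
  let ?S = "geometric_mat q (A l) k" and ?l = "int k \<cdot>\<^sub>v l"
  have S: "?S \<in> carrier_mat q q" using B by simp
  have C: "A ?l \<in> carrier_mat q q" using l by (intro lattice_action_carrier[OF A]) simp
  have Cw: "rmat (A ?l) *\<^sub>v w \<in> carrier_vec q" using C w by (rule rmat_mult_carrier)
  have "real_of_int M \<cdot>\<^sub>v (rmat ?S *\<^sub>v t l) = rmat ?S *\<^sub>v (real_of_int M \<cdot>\<^sub>v t l)"
    by (rule rmat_smult_vec[OF S tl, symmetric])
  also have "\<dots> = rmat ?S *\<^sub>v (rmat (A l) *\<^sub>v w - w) + rmat ?S *\<^sub>v map_vec real_of_int u"
    unfolding Mt by (rule rmat_add_vec[OF S Bw]) (use u in simp)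
  also have "rmat ?S *\<^sub>v map_vec real_of_int u = map_vec real_of_int (M \<cdot>\<^sub>v y)"
    using of_int_hom.mult_mat_vec_hom[OF S u(1)] y(2) by metis
  also have "rmat ?S *\<^sub>v (rmat (A l) *\<^sub>v w - w) = rmat (A ?l) *\<^sub>v w - w"
    by (rule rmat_geometric_mat_diff[OF A l w])
  finally have MS: "real_of_int M \<cdot>\<^sub>v (rmat ?S *\<^sub>v t l) = (rmat (A ?l) *\<^sub>v w - w) + map_vec real_of_int (M \<cdot>\<^sub>v y)" .
  have St: "rmat ?S *\<^sub>v t l \<in> carrier_vec q" using S tl by (rule rmat_mult_carrier)
  have Mi: "real_of_int M * (rmat ?S *\<^sub>v t l) $ i = (rmat (A ?l) *\<^sub>v w) $ i - w $ i + real_of_int M * real_of_int (y $ i)"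
    if "i < q" for i
    using arg_cong[OF MS, of "\<lambda>v. v $ i"] that carrier_vecD[OF St] carrier_vecD[OF Cw] w y(1)
    by (simp del: index_mult_mat_vec dim_mult_mat_vec)
  \<comment> \<open>The fixed point must satisfy (A(k l) - 1) x = - t(k l) on the torus, which
    dictates the factor -1/M.\<close>
  define x where "x = (- 1 / real_of_int M) \<cdot>\<^sub>v w"
  have x: "x \<in> carrier_vec q" using w by (simp add: x_def)
  have Cx: "rmat (A ?l) *\<^sub>v x = (- 1 / real_of_int M) \<cdot>\<^sub>v (rmat (A ?l) *\<^sub>v w)"
    unfolding x_def by (rule rmat_smult_vec[OF C w])
  have "torus_eq q (rmat (A ?l) *\<^sub>v x + t ?l) (rmat (A ?l) *\<^sub>v x + rmat ?S *\<^sub>v t l)"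
    by (rule torus_eq_add[OF torus_eq_refl[OF rmat_mult_carrier[OF C x]] torus_cocycle_smult[OF A t l]])
  also have "torus_eq q \<dots> x"
  proof -
    have "(rmat (A ?l) *\<^sub>v x + rmat ?S *\<^sub>v t l) $ i - x $ i = real_of_int (y $ i)" if "i < q" for i
      using Mi[OF that] that M carrier_vecD[OF St] carrier_vecD[OF Cw] w unfolding Cx
      by (simp add: x_def field_simps del: index_mult_mat_vec dim_mult_mat_vec)
    then show ?thesis
      using x St rmat_mult_carrier[OF C x] by (auto simp: torus_eq_iff simp del: index_add_vec(1))
  qed
  finally show ?thesis using that k x by blast
qed

section \<open>Lattice actions\<close>

lemma mat_eqI_vec:
  assumes M: "(M :: int mat) \<in> carrier_mat m n" and M': "M' \<in> carrier_mat m n"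
    and eq: "\<And>x. x \<in> carrier_vec n \<Longrightarrow> M *\<^sub>v x = M' *\<^sub>v x"
  shows "M = M'"
proof (rule eq_matI)
  fix i j assume "i < dim_row M'" "j < dim_col M'"
  then have ij: "i < m" "j < n" using M' by auto
  have "(N *\<^sub>v unit_vec n j) $ i = N $$ (i, j)" if "N \<in> carrier_mat m n" for N :: "int mat"
    using that ij by (simp add: scalar_prod_right_unit)
  then show "M $$ (i, j) = M' $$ (i, j)" using eq[of "unit_vec n j"] M M' by (metis unit_vec_carrier)
qed (use M M' in auto)

text \<open>Induction on the sum of the absolute values of the coordinates: a step against the sign
  of some non-zero coordinate lowers it.\<close>

lemma int_vec_induct [consumes 1, case_names zero plus minus]:
  assumes "(l :: int vec) \<in> carrier_vec p"
    and zero: "P (0\<^sub>v p)"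
    and plus: "\<And>l i. l \<in> carrier_vec p \<Longrightarrow> i < p \<Longrightarrow> P l \<Longrightarrow> P (l + unit_vec p i)"
    and minus: "\<And>l i. l \<in> carrier_vec p \<Longrightarrow> i < p \<Longrightarrow> P l \<Longrightarrow> P (l - unit_vec p i)"
  shows "P l"
  using assms(1)
proof (induction "\<Sum>i<p. nat \<bar>l $ i\<bar>" arbitrary: l rule: less_induct)
  case less
  note l = \<open>l \<in> carrier_vec p\<close>
  show ?case
  proof (cases "l = 0\<^sub>v p")
    case False
    then obtain i where i: "i < p" "l $ i \<noteq> 0" using l by (metis carrier_vecD eq_vecI index_zero_vec)
    define s :: int where "s = sgn (l $ i)"
    define k where "k = l - s \<cdot>\<^sub>v unit_vec p i"
    have k: "k \<in> carrier_vec p" using l by (simp add: k_def)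
    have kj: "k $ j = (if j = i then l $ i - s else l $ j)" if "j < p" for j
      using l that i by (simp add: k_def)
    have "(\<Sum>j<p. nat \<bar>k $ j\<bar>) < (\<Sum>j<p. nat \<bar>l $ j\<bar>)"
    proof (rule sum_strict_mono_ex1)
      show "\<forall>j\<in>{..<p}. nat \<bar>k $ j\<bar> \<le> nat \<bar>l $ j\<bar>"
        by (auto simp: kj s_def sgn_if)
      show "\<exists>j\<in>{..<p}. nat \<bar>k $ j\<bar> < nat \<bar>l $ j\<bar>"
        using i by (intro bexI[of _ i]) (auto simp: kj s_def sgn_if)
    qed simp
    then have Pk: "P k" using less(1) k by blast
    show ?thesis
    proof (cases "l $ i > 0")
      case True
      then have "l = k + unit_vec p i" using l by (intro eq_vecI) (auto simp: k_def s_def)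
      with plus[OF k i(1) Pk] show ?thesis by simp
    next
      case False
      then have "l = k - unit_vec p i" using l i by (intro eq_vecI) (auto simp: k_def s_def)
      with minus[OF k i(1) Pk] show ?thesis by simp
    qed
  qed (use zero in simp)
qed

text \<open>Over the integers additivity already gives linearity, so the values on unit vectors form
  the matrix. This turns the two halves of a lattice decomposition into matrices.\<close>

lemma additive_map_matrix:
  fixes f :: "int vec \<Rightarrow> int vec"
  assumes f: "\<And>x. x \<in> carrier_vec n \<Longrightarrow> f x \<in> carrier_vec m"
    and add: "\<And>x y. x \<in> carrier_vec n \<Longrightarrow> y \<in> carrier_vec n \<Longrightarrow> f (x + y) = f x + f y"
  obtains M where "M \<in> carrier_mat m n" "\<And>x. x \<in> carrier_vec n \<Longrightarrow> f x = M *\<^sub>v x"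
proof -
  define M where "M = mat m n (\<lambda>(i, j). f (unit_vec n j) $ i)"
  have M: "M \<in> carrier_mat m n" by (simp add: M_def)
  have unit: "M *\<^sub>v unit_vec n j = f (unit_vec n j)" if "j < n" for j
    using that f[of "unit_vec n j"] by (intro eq_vecI) (auto simp: M_def scalar_prod_right_unit)
  have "f x = M *\<^sub>v x" if "x \<in> carrier_vec n" for x
    using that
  proof (induction rule: int_vec_induct)
    case zero
    have "f (0\<^sub>v n) + f (0\<^sub>v n) = f (0\<^sub>v n)" using add[of "0\<^sub>v n" "0\<^sub>v n"] by simp
    then have "f (0\<^sub>v n) $ i = 0" if "i < m" for i
      using f[of "0\<^sub>v n"] that by (metis add_cancel_right_right carrier_vecD index_add_vec(1) zero_carrier_vec)
    then have "f (0\<^sub>v n) = 0\<^sub>v m" using f[of "0\<^sub>v n"] by (intro eq_vecI) auto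
    moreover have "M *\<^sub>v 0\<^sub>v n = 0\<^sub>v m" using M by auto
    ultimately show ?case by simp
  next
    case (plus x i)
    then show ?case using add[of x "unit_vec n i"] unit[of i] M by (simp add: mult_add_distrib_mat_vec[of _ m n])
  next
    case (minus x i)
    let ?e = "unit_vec n i :: int vec"
    have "x - ?e + ?e = x" using minus by (intro eq_vecI) auto
    then have "f x = f (x - ?e) + f ?e" using add[of "x - ?e" ?e] minus by simp
    then have "f x - f ?e = f (x - ?e)"
      using f[of "x - ?e"] f[of ?e] minus by (intro eq_vecI) auto
    moreover have "M *\<^sub>v (x - ?e) = M *\<^sub>v x - M *\<^sub>v ?e"
      using minus by (intro mult_minus_distrib_mat_vec[OF M]) auto
    ultimately show ?case using minus unit by simp
  qed
  with M show ?thesis using that by blast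
qed

lemma lattice_action_fixed:
  assumes A: "lattice_action p q A" and v: "v \<in> carrier_vec q" and l: "l \<in> carrier_vec p"
    and gen: "\<And>i. i < p \<Longrightarrow> A (unit_vec p i) *\<^sub>v v = v"
  shows "A l *\<^sub>v v = v"
  using l
proof (induction rule: int_vec_induct)
  case zero
  show ?case using v by (simp add: lattice_action_zero[OF A])
next
  case (plus l i)
  have "A (l + unit_vec p i) *\<^sub>v v = A l *\<^sub>v (A (unit_vec p i) *\<^sub>v v)"
    unfolding lattice_action_add[OF A plus(1) unit_vec_carrier]
    by (rule assoc_mult_mat_vec[of _ q q _ q]) (use v plus(1) in \<open>auto intro: lattice_action_carrier[OF A]\<close>)
  then show ?case using plus gen by simp
next
  case (minus l i)
  let ?e = "unit_vec p i"
  have c: "l - ?e \<in> carrier_vec p" using minus(1) by simp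
  have "l - ?e + ?e = l" using minus(1) by (intro eq_vecI) auto
  \<comment> \<open>Inverting the generator is avoided: since it fixes v, A(l - e) v = A(l - e)
    (A(e) v) = A(l) v.\<close>
  then have "A l *\<^sub>v v = (A (l - ?e) * A ?e) *\<^sub>v v"
    using lattice_action_add[OF A c unit_vec_carrier[of p i]] by simp
  also have "\<dots> = A (l - ?e) *\<^sub>v (A ?e *\<^sub>v v)"
    by (rule assoc_mult_mat_vec[of _ q q _ q]) (use v c in \<open>auto intro: lattice_action_carrier[OF A]\<close>)
  finally show ?case using minus gen by simp
qed

text \<open>If v were non-zero, applying each operator as often as possible without reaching zero
  would lead to a non-zero common null vector inside the invariant set Z. The outer induction is on
  the number d of operators not yet known to annihilate v, the inner one on the exponent b for the
  next operator \<open>T m\<close>; commutation keeps what is already annihilated.\<close>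

lemma commuting_nilpotent_kernel:
  fixes T :: "nat \<Rightarrow> int mat"
  assumes T: "\<And>i. i < p \<Longrightarrow> T i \<in> carrier_mat q q"
    and comm: "\<And>i j. i < p \<Longrightarrow> j < p \<Longrightarrow> T i * T j = T j * T i"
    and Z: "Z \<subseteq> carrier_vec q" and TZ: "\<And>i v. i < p \<Longrightarrow> v \<in> Z \<Longrightarrow> T i *\<^sub>v v \<in> Z"
    and kernel: "\<And>v. v \<in> Z \<Longrightarrow> (\<And>i. i < p \<Longrightarrow> T i *\<^sub>v v = 0\<^sub>v q) \<Longrightarrow> v = 0\<^sub>v q"
    and v: "v \<in> Z" "\<And>i. i < p \<Longrightarrow> \<exists>b. T i ^\<^sub>m b *\<^sub>v v = 0\<^sub>v q"
  shows "v = 0\<^sub>v q"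
proof -
  have vanish: "T i ^\<^sub>m b *\<^sub>v (T m *\<^sub>v v) = 0\<^sub>v q"
    if "i < p" "m < p" "v \<in> Z" "T i ^\<^sub>m b *\<^sub>v v = 0\<^sub>v q" for i m b v
  proof -
    have Tc: "T i ^\<^sub>m b \<in> carrier_mat q q" "T m \<in> carrier_mat q q" using T that by auto
    have vc: "v \<in> carrier_vec q" using that Z by auto
    have "T i ^\<^sub>m b *\<^sub>v (T m *\<^sub>v v) = (T i ^\<^sub>m b * T m) *\<^sub>v v"
      by (rule assoc_mult_mat_vec[OF Tc vc, symmetric])
    also have "T i ^\<^sub>m b * T m = T m * T i ^\<^sub>m b"
      using pow_mat_commute[of "T i" q "T m" b] T that comm by simp
    also have "(T m * T i ^\<^sub>m b) *\<^sub>v v = T m *\<^sub>v (T i ^\<^sub>m b *\<^sub>v v)"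
      by (rule assoc_mult_mat_vec[OF Tc(2,1) vc])
    also have "\<dots> = 0\<^sub>v q" using that(4) Tc by auto
    finally show ?thesis .
  qed
  have "\<forall>v\<in>Z. (\<forall>i<m. T i *\<^sub>v v = 0\<^sub>v q) \<longrightarrow> (\<forall>i<p. \<exists>b. T i ^\<^sub>m b *\<^sub>v v = 0\<^sub>v q) \<longrightarrow> v = 0\<^sub>v q"
    if "p = m + d" for m d
    using that
  proof (induction d arbitrary: m)
    case 0
    then show ?case using kernel by auto
  next
    case (Suc d)
    have m: "m < p" using Suc(2) by simp
    have IH: "v = 0\<^sub>v q" if "v \<in> Z" "\<forall>i<m. T i *\<^sub>v v = 0\<^sub>v q" "T m *\<^sub>v v = 0\<^sub>v q"
      "\<forall>i<p. \<exists>b. T i ^\<^sub>m b *\<^sub>v v = 0\<^sub>v q" for v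
      using Suc(1)[of "Suc m"] Suc(2) that by (auto simp: less_Suc_eq)
    have "v = 0\<^sub>v q" if "v \<in> Z" "\<forall>i<m. T i *\<^sub>v v = 0\<^sub>v q" "\<forall>i<p. \<exists>b. T i ^\<^sub>m b *\<^sub>v v = 0\<^sub>v q"
      "T m ^\<^sub>m b *\<^sub>v v = 0\<^sub>v q" for v b
      using that
    proof (induction b arbitrary: v)
      case 0
      have "v \<in> carrier_vec q" using 0(1) Z by auto
      then show ?case using 0(4) T[OF m] by simp
    next
      case (Suc b)
      have vc: "v \<in> carrier_vec q" using Suc(2) Z by auto
      have Tv: "T m *\<^sub>v v \<in> Z" by (rule TZ[OF m Suc(2)])
      \<comment> \<open>\<open>T m\<close> applied to v has a smaller exponent and inherits all
        other hypotheses, so it vanishes. Then v is annihilated by one operator more and the outer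
        hypothesis \<open>IH\<close> applies.\<close>
      have "T m *\<^sub>v v = 0\<^sub>v q"
      proof (rule Suc(1)[OF Tv])
        show "\<forall>i<m. T i *\<^sub>v (T m *\<^sub>v v) = 0\<^sub>v q"
        proof (intro allI impI)
          fix i assume i: "i < m"
          then have "i < p" using m by simp
          with vanish[of i m v 1] i Suc(2,3) T[of i] m show "T i *\<^sub>v (T m *\<^sub>v v) = 0\<^sub>v q" by simp
        qed
        show "\<forall>i<p. \<exists>b. T i ^\<^sub>m b *\<^sub>v (T m *\<^sub>v v) = 0\<^sub>v q"
          using vanish m Suc(2,4) by blast
        have "T m ^\<^sub>m b *\<^sub>v (T m *\<^sub>v v) = T m ^\<^sub>m Suc b *\<^sub>v v"
          using T[OF m] vc by (simp add: assoc_mult_mat_vec[of _ q q _ q])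
        then show "T m ^\<^sub>m b *\<^sub>v (T m *\<^sub>v v) = 0\<^sub>v q" using Suc(5) by simp
      qed
      then show ?case using IH Suc(2-4) by blast
    qed
    then show ?case using m by blast
  qed
  from this[of 0 p] v show ?thesis by auto
qed

text \<open>Expand \<open>t (k + l) = t (l + k)\<close> in both orders. Thus \<open>A k - 1\<close>
  turns t into the coboundary of the single vector \<open>t k\<close>, which is how the augmentation
  ideal kills cohomology.\<close>

lemma torus_cocycle_commute:
  assumes A: "lattice_action p q A" and t: "torus_cocycle p q A t"
    and k: "k \<in> carrier_vec p" and l: "l \<in> carrier_vec p"
  shows "torus_eq q (rmat (A k - 1\<^sub>m q) *\<^sub>v t l) (rmat (A l) *\<^sub>v t k - t k)"
proof -
  have tk: "t k \<in> carrier_vec q" and tl: "t l \<in> carrier_vec q"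
    using torus_cocycle_carrier[OF t] k l by auto
  have kl: "rmat (A k) *\<^sub>v t l \<in> carrier_vec q" and lk: "rmat (A l) *\<^sub>v t k \<in> carrier_vec q"
    using rmat_mult_carrier lattice_action_carrier[OF A] k l tk tl by blast+
  have "k + l = l + k" using k l by (rule comm_add_vec)
  then have "torus_eq q (rmat (A k) *\<^sub>v t l + t k) (rmat (A l) *\<^sub>v t k + t l)"
    using torus_eq_trans[OF torus_eq_sym[OF torus_cocycle_add[OF t k l]]] torus_cocycle_add[OF t l k] by simp
  then have "torus_eq q ((rmat (A k) *\<^sub>v t l + t k) - (t k + t l)) ((rmat (A l) *\<^sub>v t k + t l) - (t k + t l))"
    by (rule torus_eq_diff[OF _ torus_eq_refl]) (use tk tl in simp)
  moreover have "(rmat (A k) *\<^sub>v t l + t k) - (t k + t l) = rmat (A k) *\<^sub>v t l - t l"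
    and "(rmat (A l) *\<^sub>v t k + t l) - (t k + t l) = rmat (A l) *\<^sub>v t k - t k"
    using tk tl carrier_vecD[OF kl] carrier_vecD[OF lk]
    by (auto intro!: eq_vecI simp del: index_mult_mat_vec dim_mult_mat_vec)
  moreover have "rmat (A k - 1\<^sub>m q) *\<^sub>v t l = rmat (A k) *\<^sub>v t l - t l"
    using lattice_action_carrier[OF A k] tl by (simp add: rmat_diff_mult_vec[of _ q q] rmat_one_vec)
  ultimately show ?thesis by simp
qed

section \<open>Splitting off the unipotent part\<close>

lemma commute_mult_mat:
  assumes "(X :: 'a :: comm_ring_1 mat) \<in> carrier_mat n n" "B \<in> carrier_mat n n" "C \<in> carrier_mat n n"
    and XB: "X * B = B * X" and XC: "X * C = C * X"
  shows "X * (B * C) = B * C * X"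
proof -
  have "X * (B * C) = B * X * C" using assms(1-3) by (simp add: XB[symmetric] assoc_mult_mat[of _ n n _ n _ n])
  also have "\<dots> = B * C * X" using assms(1-3) by (simp add: XC assoc_mult_mat[of _ n n _ n _ n])
  finally show ?thesis .
qed

lemma commute_shift_mat:
  assumes "(X :: int mat) \<in> carrier_mat n n" "B \<in> carrier_mat n n" and XB: "X * B = B * X"
  shows "X * (c \<cdot>\<^sub>m 1\<^sub>m n - B) = (c \<cdot>\<^sub>m 1\<^sub>m n - B) * X"
  using assms by (simp add: mult_minus_distrib_mat[of _ n n _ n] minus_mult_distrib_mat[of _ n n _ _ n]
      mult_smult_distrib[of _ n n _ n] mult_smult_assoc_mat[of _ n n _ n])

lemma lattice_action_commute:
  assumes "lattice_action p q A" "k \<in> carrier_vec p" "l \<in> carrier_vec p"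
  shows "A k * A l = A l * A k"
  using lattice_action_add[OF assms(1)] assms(2,3) comm_add_vec by metis

lemma lattice_action_commute_diff:
  assumes A: "lattice_action p q A" and X: "X \<in> carrier_mat q q" and k: "k \<in> carrier_vec p"
    and XA: "X * A k = A k * X"
  shows "X * (A k - 1\<^sub>m q) = (A k - 1\<^sub>m q) * X"
  using X XA lattice_action_carrier[OF A k]
  by (simp add: mult_minus_distrib_mat[of _ q q _ q] minus_mult_distrib_mat[of _ q q _ _ q])

lemma intertwine_pow_mat:
  assumes "(S :: int mat) \<in> carrier_mat m n" "B \<in> carrier_mat n n" "C \<in> carrier_mat m m"
    and SB: "S * B = C * S"
  shows "S * B ^\<^sub>m k = C ^\<^sub>m k * S"
proof (induction k)
  case (Suc k)
  have "S * B ^\<^sub>m Suc k = S * B ^\<^sub>m k * B"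
    using assms(1-3) by (simp add: assoc_mult_mat[of _ m n _ n _ n])
  also have "\<dots> = C ^\<^sub>m k * (S * B)"
    unfolding Suc using assms(1-3) by (simp add: assoc_mult_mat[of _ m m _ n _ n])
  also have "\<dots> = C ^\<^sub>m Suc k * S"
    unfolding SB using assms(1-3) by (simp add: assoc_mult_mat[of _ m m _ m _ n])
  finally show ?case .
qed (use assms in simp)

text \<open>On the part of the lattice where the action is unipotent, \<open>u\<close> is multiplication by \<open>N\<close>, and
  it vanishes on the complementary part. It is the product over the generators \<open>e\<^sub>i\<close> of \<open>\<int>\<^sup>p\<close> of
  the polynomials \<open>n\<^sub>i - T\<^sub>i\<^sup>a Y\<^sub>i\<close> in \<open>T\<^sub>i = A e\<^sub>i - 1\<close>; hence \<open>N - u\<close> lies in the ideal generated by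
  the \<open>T\<^sub>i\<close>, and so turns every cocycle into a coboundary.\<close>

lemma unipotent_projector:
  assumes A: "lattice_action p q A" and A1: "unipotent_action p q1 A1"
    and S: "S \<in> carrier_mat q1 q" and SA: "\<And>l. l \<in> carrier_vec p \<Longrightarrow> S * A l = A1 l * S"
    and nofix: "\<And>v. v \<in> carrier_vec q \<Longrightarrow> S *\<^sub>v v = 0\<^sub>v q1 \<Longrightarrow>
      (\<And>l. l \<in> carrier_vec p \<Longrightarrow> A l *\<^sub>v v = v) \<Longrightarrow> v = 0\<^sub>v q"
  obtains N u where "N \<noteq> 0" "u \<in> carrier_mat q q" "\<And>l. l \<in> carrier_vec p \<Longrightarrow> u * A l = A l * u"
    "S * u = N \<cdot>\<^sub>m S" "\<And>v. v \<in> carrier_vec q \<Longrightarrow> S *\<^sub>v v = 0\<^sub>v q1 \<Longrightarrow> u *\<^sub>v v = 0\<^sub>v q"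
    "\<And>t. torus_cocycle p q A t \<Longrightarrow> \<exists>c \<in> carrier_vec q. \<forall>l \<in> carrier_vec p.
      torus_eq q (real_of_int N \<cdot>\<^sub>v t l - rmat u *\<^sub>v t l) (rmat (A l) *\<^sub>v c - c)"
proof -
  note assoc = assoc_mult_mat[of _ q q _ q _ q] and mc = mult_carrier_mat[of _ q q _ q]
  define T where "T i = A (unit_vec p i) - 1\<^sub>m q" for i
  have Ac: "A l \<in> carrier_mat q q" if "l \<in> carrier_vec p" for l by (rule lattice_action_carrier[OF A that])
  have Tc: "T i \<in> carrier_mat q q" for i unfolding T_def by (rule minus_carrier_mat) simp
  have AT: "A l * T i = T i * A l" if "l \<in> carrier_vec p" for l i
    unfolding T_def using that
    by (intro lattice_action_commute_diff[OF A Ac] lattice_action_commute[OF A]) auto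
  have XT: "X * T i = T i * X" if "X \<in> carrier_mat q q" "\<And>l. l \<in> carrier_vec p \<Longrightarrow> X * A l = A l * X" for X i
    unfolding T_def using that by (intro lattice_action_commute_diff[OF A]) auto
  have TT: "T i * T j = T j * T i" for i j
    using XT[OF Tc AT[symmetric]] by simp
  \<comment> \<open>\<open>S\<close> intertwines \<open>T i\<close> with \<open>A1 e - 1\<close>,
    where e is the i-th unit vector, and the latter is nilpotent.\<close>
  have ST: "\<exists>a. S * T i ^\<^sub>m a = 0\<^sub>m q1 q" for i
  proof -
    let ?e = "unit_vec p i"
    have U: "unipotent_mat q1 (A1 ?e)"
      using A1 by (simp add: unipotent_action_def monoid_vec_simps)
    then obtain a where a: "(A1 ?e - 1\<^sub>m q1) ^\<^sub>m a = 0\<^sub>m q1 q1" and A1c: "A1 ?e \<in> carrier_mat q1 q1"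
      by (auto simp: unipotent_mat_def)
    have "S * T i = (A1 ?e - 1\<^sub>m q1) * S"
      using SA[of ?e] S A1c Ac[of ?e]
      by (simp add: T_def mult_minus_distrib_mat[of _ q1 q _ q] minus_mult_distrib_mat[of _ q1 q1 _ _ q])
    then have "S * T i ^\<^sub>m a = (A1 ?e - 1\<^sub>m q1) ^\<^sub>m a * S"
      by (rule intertwine_pow_mat[OF S Tc minus_carrier_mat[OF one_carrier_mat]])
    then show ?thesis using a S by auto
  qed
  \<comment> \<open>Here m counts the generators already treated, starting from u = 1 and N = 1.
    That N - u lies in the augmentation ideal is carried along in the form in which it is used:
    \<open>N t - u t\<close> is the coboundary of one vector c, the same for all l.\<close>
  have "\<exists>N u. N \<noteq> 0 \<and> u \<in> carrier_mat q q \<and> (\<forall>l \<in> carrier_vec p. u * A l = A l * u) \<and>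
      S * u = N \<cdot>\<^sub>m S \<and> (\<forall>i<m. \<exists>b. T i ^\<^sub>m b * u = 0\<^sub>m q q) \<and>
      (\<forall>t. torus_cocycle p q A t \<longrightarrow> (\<exists>c \<in> carrier_vec q. \<forall>l \<in> carrier_vec p.
        torus_eq q (real_of_int N \<cdot>\<^sub>v t l - rmat u *\<^sub>v t l) (rmat (A l) *\<^sub>v c - c)))" for m
  proof (induction m)
    case 0
    have "torus_eq q (real_of_int 1 \<cdot>\<^sub>v t l - rmat (1\<^sub>m q) *\<^sub>v t l) (rmat (A l) *\<^sub>v 0\<^sub>v q - 0\<^sub>v q)"
      if "torus_cocycle p q A t" "l \<in> carrier_vec p" for t l
    proof -
      have "t l \<in> carrier_vec q" by (rule torus_cocycle_carrier[OF that])
      moreover have "rmat (A l) *\<^sub>v 0\<^sub>v q = 0\<^sub>v q" using Ac[OF that(2)] by auto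
      ultimately show ?thesis by (simp add: rmat_one_vec torus_eq_refl)
    qed
    moreover have "S * 1\<^sub>m q = 1 \<cdot>\<^sub>m S" using S by auto
    moreover have "1\<^sub>m q * A l = A l * 1\<^sub>m q" if "l \<in> carrier_vec p" for l
      using left_mult_one_mat[OF Ac[OF that]] right_mult_one_mat[OF Ac[OF that]] by simp
    ultimately show ?case
      by (intro exI[of _ 1] exI[of _ "1\<^sub>m q"]) (auto intro!: bexI[of _ "0\<^sub>v q"])
  next
    case (Suc m)
    then obtain N u where N: "N \<noteq> 0" and u: "u \<in> carrier_mat q q"
      and uA: "\<And>l. l \<in> carrier_vec p \<Longrightarrow> u * A l = A l * u"
      and Su: "S * u = N \<cdot>\<^sub>m S" and Tu: "\<And>i. i < m \<Longrightarrow> \<exists>b. T i ^\<^sub>m b * u = 0\<^sub>m q q"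
      and cu: "\<And>t. torus_cocycle p q A t \<Longrightarrow> \<exists>c \<in> carrier_vec q. \<forall>l \<in> carrier_vec p.
        torus_eq q (real_of_int N \<cdot>\<^sub>v t l - rmat u *\<^sub>v t l) (rmat (A l) *\<^sub>v c - c)"
      by blast
    let ?T = "T m" and ?e = "unit_vec p m"
    note Tm = Tc[of m]
    obtain a where a: "S * ?T ^\<^sub>m a = 0\<^sub>m q1 q" using ST by blast
    \<comment> \<open>The exponent \<open>Suc a\<close> makes \<open>S\<close> kill the polynomial Z
      below and, even for a = 0, leaves one factor \<open>?T\<close> to split off.\<close>
    obtain n Y b where n: "n \<noteq> 0" and Y: "Y \<in> carrier_mat q q"
      and XY: "\<And>X. X \<in> carrier_mat q q \<Longrightarrow> X * ?T = ?T * X \<Longrightarrow> X * Y = Y * X"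
      and b: "?T ^\<^sub>m b * (n \<cdot>\<^sub>m 1\<^sub>m q - ?T ^\<^sub>m Suc a * Y) = 0\<^sub>m q q"
      using fitting_polynomial[OF Tm, where a = "Suc a"] by metis
    define Z where "Z = ?T ^\<^sub>m Suc a * Y"
    define g where "g = n \<cdot>\<^sub>m 1\<^sub>m q - Z"
    \<comment> \<open>W is \<open>u * Z\<close> with one factor \<open>?T\<close> removed. As
      \<open>?T\<close> sends t to the coboundary of \<open>t ?e\<close>, the product
      \<open>u * Z\<close> sends t to the coboundary of \<open>W t ?e\<close>.\<close>
    define W where "W = u * (?T ^\<^sub>m a * Y)"
    have Ta: "?T ^\<^sub>m a \<in> carrier_mat q q" "?T ^\<^sub>m b \<in> carrier_mat q q" "?T ^\<^sub>m Suc a \<in> carrier_mat q q"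
      using Tm by (auto intro!: pow_carrier_mat)
    have Z: "Z \<in> carrier_mat q q" unfolding Z_def using Ta Y by (simp add: mc del: pow_mat.simps)
    have g: "g \<in> carrier_mat q q" unfolding g_def by (rule minus_carrier_mat[OF Z])
    have W: "W \<in> carrier_mat q q" unfolding W_def using u Ta Y by (simp add: mc)
    have XZ: "X * Z = Z * X" and Xg: "X * g = g * X" and XW': "X * (?T ^\<^sub>m a * Y) = ?T ^\<^sub>m a * Y * X"
      if X: "X \<in> carrier_mat q q" and comm: "\<And>l. l \<in> carrier_vec p \<Longrightarrow> X * A l = A l * X" for X
    proof -
      have XTm: "X * ?T = ?T * X" by (rule XT[OF that])
      show XZ: "X * Z = Z * X" unfolding Z_def
        by (rule commute_mult_mat[OF X Ta(3) Y pow_mat_commute[OF Tm X XTm] XY[OF X XTm]])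
      show "X * g = g * X" unfolding g_def by (rule commute_shift_mat[OF X Z XZ])
      show "X * (?T ^\<^sub>m a * Y) = ?T ^\<^sub>m a * Y * X"
        by (rule commute_mult_mat[OF X Ta(1) Y pow_mat_commute[OF Tm X XTm] XY[OF X XTm]])
    qed
    have AA: "A l * A l' = A l' * A l" if "l \<in> carrier_vec p" "l' \<in> carrier_vec p" for l l'
      by (rule lattice_action_commute[OF A that])
    have Ag: "A l * g = g * A l" and AW: "A l * W = W * A l" if l: "l \<in> carrier_vec p" for l
    proof -
      show "A l * g = g * A l" by (rule Xg[OF Ac[OF l] AA[OF l]])
      show "A l * W = W * A l" unfolding W_def
        by (rule commute_mult_mat[OF Ac[OF l] u _ uA[OF l, symmetric] XW'[OF Ac[OF l] AA[OF l]]])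
          (use Ta Y in \<open>simp add: mc\<close>)
    qed
    have WT: "W * ?T = u * Z"
    proof -
      have "Y * ?T = ?T * Y" using XY[OF Tm refl] by simp
      then show ?thesis unfolding W_def Z_def using u Ta Y Tm by (simp add: assoc mc)
    qed
    have "N * n \<noteq> 0" using N n by simp
    moreover have "u * g \<in> carrier_mat q q" using u g by (simp add: mc)
    moreover have "u * g * A l = A l * (u * g)" if "l \<in> carrier_vec p" for l
      by (rule commute_mult_mat[OF Ac[OF that] u g uA[OF that, symmetric] Ag[OF that], symmetric])
    moreover have "S * (u * g) = (N * n) \<cdot>\<^sub>m S"
    proof -
      have "S * ?T ^\<^sub>m Suc a = S * ?T ^\<^sub>m a * ?T"
        using S Ta Tm by (simp add: assoc_mult_mat[of _ q1 q _ q _ q])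
      then have "S * ?T ^\<^sub>m Suc a = 0\<^sub>m q1 q" using a Tm by simp
      moreover have "S * Z = S * ?T ^\<^sub>m Suc a * Y"
        unfolding Z_def by (rule assoc_mult_mat[OF S Ta(3) Y, symmetric])
      ultimately have "S * Z = 0\<^sub>m q1 q" using Y by simp
      then have "S * g = n \<cdot>\<^sub>m S"
        unfolding g_def using S Z
        by (simp add: mult_minus_distrib_mat[of _ q1 q _ q] mult_smult_distrib[of _ q1 q _ q]) auto
      moreover have "S * (u * g) = N \<cdot>\<^sub>m (S * g)"
        using S u g Su by (simp add: assoc_mult_mat[of _ q1 q _ q _ q, symmetric] mult_smult_assoc_mat[of _ q1 q _ q])
      ultimately show ?thesis by (auto simp: mult.assoc)
    qed
    moreover have "\<exists>b. T i ^\<^sub>m b * (u * g) = 0\<^sub>m q q" if i: "i < Suc m" for i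
    proof (cases "i = m")
      case True
      \<comment> \<open>The new factor g handles the new generator by the choice of b; the earlier
        generators are handled by u.\<close>
      have "?T ^\<^sub>m b * (u * g) = (?T ^\<^sub>m b * g) * u"
        using Ta u g Xg[OF u] uA by (simp add: assoc)
      also have "\<dots> = 0\<^sub>m q q" using b u by (simp add: g_def Z_def del: pow_mat.simps)
      finally show ?thesis using True by blast
    next
      case False
      then obtain b where b: "T i ^\<^sub>m b * u = 0\<^sub>m q q" using Tu[of i] i by auto
      have "T i ^\<^sub>m b * (u * g) = T i ^\<^sub>m b * u * g"
        using Tc[of i] u g by (simp add: assoc)
      then show ?thesis using b g by auto
    qed
    moreover have "\<exists>c \<in> carrier_vec q. \<forall>l \<in> carrier_vec p.
        torus_eq q (real_of_int (N * n) \<cdot>\<^sub>v t l - rmat (u * g) *\<^sub>v t l) (rmat (A l) *\<^sub>v c - c)"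
      if t: "torus_cocycle p q A t" for t
    proof -
      obtain c where c: "c \<in> carrier_vec q" and ceq: "\<And>l. l \<in> carrier_vec p \<Longrightarrow>
          torus_eq q (real_of_int N \<cdot>\<^sub>v t l - rmat u *\<^sub>v t l) (rmat (A l) *\<^sub>v c - c)"
        using cu[OF t] by blast
      have te: "t ?e \<in> carrier_vec q" by (rule torus_cocycle_carrier[OF t]) simp
      have Wte: "rmat W *\<^sub>v t ?e \<in> carrier_vec q" by (rule rmat_mult_carrier[OF W te])
      \<comment> \<open>From u g = n u - u Z follows N n t - u g t = n (N t - u t) + u Z t, a sum of
        the coboundaries of n c and of W t(e).\<close>
      let ?c = "real_of_int n \<cdot>\<^sub>v c + rmat W *\<^sub>v t ?e"
      have "torus_eq q (real_of_int (N * n) \<cdot>\<^sub>v t l - rmat (u * g) *\<^sub>v t l) (rmat (A l) *\<^sub>v ?c - ?c)"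
        if l: "l \<in> carrier_vec p" for l
      proof -
        have tl: "t l \<in> carrier_vec q" by (rule torus_cocycle_carrier[OF t l])
        have ut: "rmat u *\<^sub>v t l \<in> carrier_vec q" by (rule rmat_mult_carrier[OF u tl])
        have Zt: "rmat Z *\<^sub>v t l \<in> carrier_vec q" by (rule rmat_mult_carrier[OF Z tl])
        have Tt: "rmat ?T *\<^sub>v t l \<in> carrier_vec q" by (rule rmat_mult_carrier[OF Tm tl])
        have WTt: "rmat W *\<^sub>v (rmat ?T *\<^sub>v t l) \<in> carrier_vec q" by (rule rmat_mult_carrier[OF W Tt])
        have gt: "rmat g *\<^sub>v t l = real_of_int n \<cdot>\<^sub>v t l - rmat Z *\<^sub>v t l"
          unfolding g_def using Z tl by (simp add: rmat_diff_mult_vec[of _ q q] rmat_smult_one_vec)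
        have uZt: "rmat u *\<^sub>v (rmat Z *\<^sub>v t l) = rmat W *\<^sub>v (rmat ?T *\<^sub>v t l)"
          using rmat_mult_vec[OF u Z tl] rmat_mult_vec[OF W Tm tl] WT by simp
        have "rmat (u * g) *\<^sub>v t l = real_of_int n \<cdot>\<^sub>v (rmat u *\<^sub>v t l) - rmat W *\<^sub>v (rmat ?T *\<^sub>v t l)"
          unfolding rmat_mult_vec[OF u g tl] gt uZt[symmetric] rmat_smult_vec[OF u tl, symmetric]
          by (rule rmat_diff_vec[OF u _ Zt]) (use tl in simp)
        then have "real_of_int (N * n) \<cdot>\<^sub>v t l - rmat (u * g) *\<^sub>v t l
            = real_of_int n \<cdot>\<^sub>v (real_of_int N \<cdot>\<^sub>v t l - rmat u *\<^sub>v t l) + rmat W *\<^sub>v (rmat ?T *\<^sub>v t l)"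
          using tl carrier_vecD[OF ut] carrier_vecD[OF WTt]
          by (intro eq_vecI) (simp_all add: algebra_simps del: index_mult_mat_vec dim_mult_mat_vec)
        also have "torus_eq q \<dots>
          (real_of_int n \<cdot>\<^sub>v (rmat (A l) *\<^sub>v c - c) + rmat W *\<^sub>v (rmat (A l) *\<^sub>v t ?e - t ?e))"
          unfolding T_def
          by (intro torus_eq_add torus_eq_smult[OF ceq[OF l]] torus_eq_mult[OF W]
              torus_cocycle_commute[OF A t _ l]) simp
        also have "\<dots> = rmat (A l) *\<^sub>v ?c - ?c"
        proof -
          have Ac': "rmat (A l) *\<^sub>v c \<in> carrier_vec q" by (rule rmat_mult_carrier[OF Ac[OF l] c])
          have Ate: "rmat (A l) *\<^sub>v t ?e \<in> carrier_vec q" by (rule rmat_mult_carrier[OF Ac[OF l] te])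
          have AWte: "rmat (A l) *\<^sub>v (rmat W *\<^sub>v t ?e) \<in> carrier_vec q"
            by (rule rmat_mult_carrier[OF Ac[OF l] Wte])
          have 1: "rmat W *\<^sub>v (rmat (A l) *\<^sub>v t ?e) = rmat (A l) *\<^sub>v (rmat W *\<^sub>v t ?e)"
            using rmat_mult_vec[OF W Ac[OF l] te] rmat_mult_vec[OF Ac[OF l] W te] AW[OF l] by simp
          have 2: "rmat (A l) *\<^sub>v ?c = real_of_int n \<cdot>\<^sub>v (rmat (A l) *\<^sub>v c) + rmat (A l) *\<^sub>v (rmat W *\<^sub>v t ?e)"
            using rmat_add_vec[OF Ac[OF l] _ Wte] rmat_smult_vec[OF Ac[OF l] c] c by simp
          show ?thesis
            unfolding rmat_diff_vec[OF W Ate te] 1 2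
            using c carrier_vecD[OF Ac'] carrier_vecD[OF AWte] carrier_vecD[OF Wte]
            by (intro eq_vecI) (simp_all add: algebra_simps del: index_mult_mat_vec dim_mult_mat_vec)
        qed
        finally show ?thesis .
      qed
      moreover have "?c \<in> carrier_vec q" using c Wte by simp
      ultimately show ?thesis by blast
    qed
    ultimately show ?case by blast
  qed
  from this[of p] obtain N u where N: "N \<noteq> 0" and u: "u \<in> carrier_mat q q"
    and uA: "\<And>l. l \<in> carrier_vec p \<Longrightarrow> u * A l = A l * u"
    and Su: "S * u = N \<cdot>\<^sub>m S" and Tu: "\<And>i. i < p \<Longrightarrow> \<exists>b. T i ^\<^sub>m b * u = 0\<^sub>m q q"
    and cu: "\<And>t. torus_cocycle p q A t \<Longrightarrow> \<exists>c \<in> carrier_vec q. \<forall>l \<in> carrier_vec p.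
      torus_eq q (real_of_int N \<cdot>\<^sub>v t l - rmat u *\<^sub>v t l) (rmat (A l) *\<^sub>v c - c)"
    by blast
  \<comment> \<open>\<open>u v\<close> stays in the kernel of \<open>S\<close>, and some power of
    every \<open>T i\<close> annihilates it. A common null vector of all \<open>T i\<close> in that
    kernel is fixed by the whole action, hence zero by \<open>nofix\<close>.\<close>
  have "u *\<^sub>v v = 0\<^sub>v q" if v: "v \<in> carrier_vec q" "S *\<^sub>v v = 0\<^sub>v q1" for v
  proof (rule commuting_nilpotent_kernel[of p T q "{v \<in> carrier_vec q. S *\<^sub>v v = 0\<^sub>v q1}"])
    have "S *\<^sub>v (u *\<^sub>v v) = (N \<cdot>\<^sub>m S) *\<^sub>v v"
      unfolding Su[symmetric] by (rule assoc_mult_mat_vec[OF S u v(1), symmetric])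
    also have "\<dots> = N \<cdot>\<^sub>v (S *\<^sub>v v)" using S v(1) by (intro eq_vecI) auto
    also have "\<dots> = 0\<^sub>v q1" unfolding v(2) by (intro eq_vecI) auto
    finally show "u *\<^sub>v v \<in> {v \<in> carrier_vec q. S *\<^sub>v v = 0\<^sub>v q1}"
      using v u by (auto intro: mult_mat_vec_carrier)
    show "\<exists>b. T i ^\<^sub>m b *\<^sub>v (u *\<^sub>v v) = 0\<^sub>v q" if i: "i < p" for i
    proof -
      obtain b where b: "T i ^\<^sub>m b * u = 0\<^sub>m q q" using Tu[OF i] by blast
      have "T i ^\<^sub>m b *\<^sub>v (u *\<^sub>v v) = (T i ^\<^sub>m b * u) *\<^sub>v v"
        by (rule assoc_mult_mat_vec[OF pow_carrier_mat[OF Tc] u v(1), symmetric])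
      then show ?thesis using b v zero_mat_mult_vec by auto
    qed
    show "T i *\<^sub>v w \<in> {v \<in> carrier_vec q. S *\<^sub>v v = 0\<^sub>v q1}"
      if "w \<in> {v \<in> carrier_vec q. S *\<^sub>v v = 0\<^sub>v q1}" for i w
    proof -
      let ?e = "unit_vec p i"
      have w: "w \<in> carrier_vec q" "S *\<^sub>v w = 0\<^sub>v q1" using that by auto
      have A1c: "A1 ?e \<in> carrier_mat q1 q1"
        using A1 by (intro lattice_action_carrier) (auto simp: unipotent_action_def)
      have Aw: "A ?e *\<^sub>v w \<in> carrier_vec q" using Ac[of ?e] w by (auto intro: mult_mat_vec_carrier)
      have "S *\<^sub>v (A ?e *\<^sub>v w) = A1 ?e *\<^sub>v (S *\<^sub>v w)"
        using assoc_mult_mat_vec[OF S Ac w(1), of ?e] assoc_mult_mat_vec[OF A1c S w(1)] SA[of ?e] by simp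
      also have "\<dots> = 0\<^sub>v q1" using w A1c by auto
      finally have "S *\<^sub>v (A ?e *\<^sub>v w - w) = 0\<^sub>v q1"
        using w by (subst mult_minus_distrib_mat_vec[OF S Aw]) auto
      moreover have "T i *\<^sub>v w = A ?e *\<^sub>v w - w"
        unfolding T_def using Ac[of ?e] w by (subst minus_mult_distrib_mat_vec[of _ q q]) auto
      ultimately show ?thesis using w Aw by simp
    qed
    show "w = 0\<^sub>v q" if "w \<in> {v \<in> carrier_vec q. S *\<^sub>v v = 0\<^sub>v q1}"
      and Tw: "\<And>i. i < p \<Longrightarrow> T i *\<^sub>v w = 0\<^sub>v q" for w
    proof (rule nofix)
      show w: "w \<in> carrier_vec q" and "S *\<^sub>v w = 0\<^sub>v q1" using that by auto
      fix l :: "int vec" assume l: "l \<in> carrier_vec p"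
      show "A l *\<^sub>v w = w"
      proof (rule lattice_action_fixed[OF A w l])
        fix i assume i: "i < p"
        let ?e = "unit_vec p i"
        have Aw: "A ?e *\<^sub>v w \<in> carrier_vec q" using Ac[of ?e] w by (auto intro: mult_mat_vec_carrier)
        have "T i *\<^sub>v w = A ?e *\<^sub>v w - w"
          unfolding T_def using Ac[of ?e] w by (subst minus_mult_distrib_mat_vec[of _ q q]) auto
        then have "(A ?e *\<^sub>v w - w) $ j = 0" if "j < q" for j
          using Tw[OF i] that by (metis index_zero_vec(1))
        then show "A ?e *\<^sub>v w = w"
          using w carrier_vecD[OF Aw] by (intro eq_vecI) (simp_all del: index_mult_mat_vec dim_mult_mat_vec)
      qed
    qed
  qed (use Tc TT in auto)
  with N u uA Su cu show ?thesis using that by blast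
qed

section \<open>Transfer of free cocycles between the lattice and its unipotent quotient\<close>

lemma torus_cocycle_intertwine:
  assumes A: "lattice_action p n A" and A': "lattice_action p m A'" and M: "M \<in> carrier_mat m n"
    and MA: "\<And>l. l \<in> carrier_vec p \<Longrightarrow> M * A l = A' l * M" and t: "torus_cocycle p n A t"
  shows "torus_cocycle p m A' (\<lambda>l. rmat M *\<^sub>v t l)"
  unfolding torus_cocycle_def
proof (intro conjI ballI)
  have tc: "t l \<in> carrier_vec n" if "l \<in> carrier_vec p" for l by (rule torus_cocycle_carrier[OF t that])
  fix l :: "int vec" assume l: "l \<in> carrier_vec p"
  show "rmat M *\<^sub>v t l \<in> carrier_vec m" by (rule rmat_mult_carrier[OF M tc[OF l]])
  fix l' :: "int vec" assume l': "l' \<in> carrier_vec p"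
  note Ac = lattice_action_carrier[OF A l] and A'c = lattice_action_carrier[OF A' l]
  have "torus_eq m (rmat M *\<^sub>v t (l + l')) (rmat M *\<^sub>v (rmat (A l) *\<^sub>v t l' + t l))"
    by (rule torus_eq_mult[OF M torus_cocycle_add[OF t l l']])
  also have "\<dots> = rmat M *\<^sub>v (rmat (A l) *\<^sub>v t l') + rmat M *\<^sub>v t l"
    by (rule rmat_add_vec[OF M rmat_mult_carrier[OF Ac tc[OF l']] tc[OF l]])
  also have "rmat M *\<^sub>v (rmat (A l) *\<^sub>v t l') = rmat (A' l) *\<^sub>v (rmat M *\<^sub>v t l')"
    using rmat_mult_vec[OF M Ac tc[OF l']] rmat_mult_vec[OF A'c M tc[OF l']] MA[OF l] by simp
  finally show "torus_eq m (rmat M *\<^sub>v t (l + l')) (rmat (A' l) *\<^sub>v (rmat M *\<^sub>v t l') + rmat M *\<^sub>v t l)" .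
qed

text \<open>\<int>^p is torsion-free, so the multiple k l at which a fixed point appears is again
  non-zero, against freeness.\<close>

lemma free_cocycle_multiple:
  assumes A: "lattice_action p q A" and t: "torus_cocycle p q A t"
    and free: "\<forall>l \<in> carrier_vec p - {0\<^sub>v p}. \<forall>x \<in> carrier_vec q. \<not> torus_eq q (rmat (A l) *\<^sub>v x + t l) x"
    and l: "l \<in> carrier_vec p - {0\<^sub>v p}" and w: "w \<in> carrier_vec q" and M: "M \<noteq> 0"
  shows "\<not> torus_eq q (real_of_int M \<cdot>\<^sub>v t l) (rmat (A l) *\<^sub>v w - w)"
proof
  have lc: "l \<in> carrier_vec p" using l by simp
  assume "torus_eq q (real_of_int M \<cdot>\<^sub>v t l) (rmat (A l) *\<^sub>v w - w)"
  then obtain k x where k: "k \<ge> 1" and x: "x \<in> carrier_vec q"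
    "torus_eq q (rmat (A (int k \<cdot>\<^sub>v l)) *\<^sub>v x + t (int k \<cdot>\<^sub>v l)) x"
    by (rule fixed_point_of_multiple[OF A t lc w M])
  have "int k \<cdot>\<^sub>v l \<noteq> 0\<^sub>v p"
  proof
    assume eq: "int k \<cdot>\<^sub>v l = 0\<^sub>v p"
    have "l $ i = 0" if "i < p" for i
      using arg_cong[OF eq, of "\<lambda>v. v $ i"] that lc k by simp
    then have "l = 0\<^sub>v p" using lc by (intro eq_vecI) auto
    with l show False by simp
  qed
  then show False using free x lc by auto
qed

text \<open>Puts the fixed point equation into coboundary form, which equivariant matrices carry
  along.\<close>

lemma torus_eq_fixed_iff:
  assumes "a \<in> carrier_vec n" "b \<in> carrier_vec n" "x \<in> carrier_vec n"
  shows "torus_eq n (a + b) x \<longleftrightarrow> torus_eq n b (x - a)"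
  using assms by (simp add: torus_eq_iff diff_diff_eq2 add.commute)

text \<open>The section \<open>R\<close> of \<open>S\<close> need not be equivariant, but
  \<open>K = u * R\<close> is: \<open>R (A1 l x)\<close> and \<open>A l (R x)\<close> have the same
  image under \<open>S\<close>, hence differ by an element of the kernel of \<open>S\<close>, which
  u annihilates.\<close>

lemma liberated_affine_unipotent_quotient:
  assumes A: "lattice_action p q A" and A1: "unipotent_action p q1 A1"
    and S: "S \<in> carrier_mat q1 q" and R: "R \<in> carrier_mat q q1" and SR: "S * R = 1\<^sub>m q1"
    and SA: "\<And>l. l \<in> carrier_vec p \<Longrightarrow> S * A l = A1 l * S"
    and nofix: "\<And>v. v \<in> carrier_vec q \<Longrightarrow> S *\<^sub>v v = 0\<^sub>v q1 \<Longrightarrow>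
      (\<And>l. l \<in> carrier_vec p \<Longrightarrow> A l *\<^sub>v v = v) \<Longrightarrow> v = 0\<^sub>v q"
  shows "liberated_affine p q A \<longleftrightarrow> liberated_affine p q1 A1"
proof -
  obtain N u where N: "N \<noteq> 0" and u: "u \<in> carrier_mat q q"
    and uA: "\<And>l. l \<in> carrier_vec p \<Longrightarrow> u * A l = A l * u"
    and Su: "S * u = N \<cdot>\<^sub>m S"
    and uker: "\<And>v. v \<in> carrier_vec q \<Longrightarrow> S *\<^sub>v v = 0\<^sub>v q1 \<Longrightarrow> u *\<^sub>v v = 0\<^sub>v q"
    and cu: "\<And>t. torus_cocycle p q A t \<Longrightarrow> \<exists>c \<in> carrier_vec q. \<forall>l \<in> carrier_vec p.
      torus_eq q (real_of_int N \<cdot>\<^sub>v t l - rmat u *\<^sub>v t l) (rmat (A l) *\<^sub>v c - c)"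
    using unipotent_projector[OF A A1 S SA nofix] by blast
  have A1': "lattice_action p q1 A1" using A1 by (simp add: unipotent_action_def)
  note Ac = lattice_action_carrier[OF A] and A1c = lattice_action_carrier[OF A1']
  \<comment> \<open>u depends only on the image under \<open>S\<close>. This yields both
    \<open>K * S = u\<close>, as z and \<open>R (S z)\<close> have equal images, and the
    equivariance of \<open>K\<close>.\<close>
  have ueq: "u *\<^sub>v v = u *\<^sub>v w" if "v \<in> carrier_vec q" "w \<in> carrier_vec q" "S *\<^sub>v v = S *\<^sub>v w" for v w
  proof -
    have "S *\<^sub>v w \<in> carrier_vec q1" using S that by (auto intro: mult_mat_vec_carrier)
    then have "S *\<^sub>v (v - w) = 0\<^sub>v q1" using that by (simp add: mult_minus_distrib_mat_vec[OF S])
    then have "u *\<^sub>v (v - w) = 0\<^sub>v q" using uker[of "v - w"] that by simp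
    then have "u *\<^sub>v v - u *\<^sub>v w = 0\<^sub>v q" using that by (simp add: mult_minus_distrib_mat_vec[OF u])
    moreover have c: "u *\<^sub>v v \<in> carrier_vec q" "u *\<^sub>v w \<in> carrier_vec q"
      using u that by (auto intro: mult_mat_vec_carrier)
    ultimately have "(u *\<^sub>v v) $ i - (u *\<^sub>v w) $ i = 0" if "i < q" for i
      using that by (metis carrier_vecD index_minus_vec(1) index_zero_vec(1))
    then show ?thesis using carrier_vecD[OF c(1)] carrier_vecD[OF c(2)] by (intro eq_vecI) auto
  qed
  define K where "K = u * R"
  have K: "K \<in> carrier_mat q q1" unfolding K_def using u R by (rule mult_carrier_mat)
  have SRx: "S *\<^sub>v (R *\<^sub>v x) = x" if "x \<in> carrier_vec q1" for x
    using assoc_mult_mat_vec[OF S R that] SR that by simp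
  have Rc: "R *\<^sub>v x \<in> carrier_vec q" if "x \<in> carrier_vec q1" for x using R that by (rule mult_mat_vec_carrier)
  have Sc: "S *\<^sub>v x \<in> carrier_vec q1" if "x \<in> carrier_vec q" for x using S that by (rule mult_mat_vec_carrier)
  have K_vec: "K *\<^sub>v x = u *\<^sub>v (R *\<^sub>v x)" if "x \<in> carrier_vec q1" for x
    unfolding K_def by (rule assoc_mult_mat_vec[OF u R that])
  have KS: "K * S = u"
  proof (rule mat_eqI_vec[of _ q q])
    fix z :: "int vec" assume z: "z \<in> carrier_vec q"
    have "(K * S) *\<^sub>v z = u *\<^sub>v (R *\<^sub>v (S *\<^sub>v z))"
      unfolding assoc_mult_mat_vec[OF K S z] by (rule K_vec[OF Sc[OF z]])
    also have "\<dots> = u *\<^sub>v z"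
      by (rule ueq) (use z Sc Rc SRx in auto)
    finally show "(K * S) *\<^sub>v z = u *\<^sub>v z" .
  qed (use K S u in auto)
  have SK: "S * K = N \<cdot>\<^sub>m 1\<^sub>m q1"
  proof -
    have "S * K = (N \<cdot>\<^sub>m S) * R" unfolding K_def Su[symmetric] by (rule assoc_mult_mat[OF S u R, symmetric])
    then show ?thesis using SR by (simp add: mult_smult_assoc_mat[OF S R])
  qed
  have KA: "K * A1 l = A l * K" if l: "l \<in> carrier_vec p" for l
  proof (rule mat_eqI_vec[of _ q q1])
    fix x :: "int vec" assume x: "x \<in> carrier_vec q1"
    have A1x: "A1 l *\<^sub>v x \<in> carrier_vec q1" using A1c[OF l] x by (rule mult_mat_vec_carrier)
    have ARx: "A l *\<^sub>v (R *\<^sub>v x) \<in> carrier_vec q" using Ac[OF l] Rc[OF x] by (rule mult_mat_vec_carrier)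
    have "(K * A1 l) *\<^sub>v x = u *\<^sub>v (R *\<^sub>v (A1 l *\<^sub>v x))"
      unfolding assoc_mult_mat_vec[OF K A1c[OF l] x] by (rule K_vec[OF A1x])
    also have "\<dots> = u *\<^sub>v (A l *\<^sub>v (R *\<^sub>v x))"
    proof (rule ueq[OF Rc[OF A1x] ARx])
      have "S *\<^sub>v (A l *\<^sub>v (R *\<^sub>v x)) = A1 l *\<^sub>v (S *\<^sub>v (R *\<^sub>v x))"
        using assoc_mult_mat_vec[OF S Ac[OF l] Rc[OF x]] assoc_mult_mat_vec[OF A1c[OF l] S Rc[OF x]] SA[OF l] by simp
      then show "S *\<^sub>v (R *\<^sub>v (A1 l *\<^sub>v x)) = S *\<^sub>v (A l *\<^sub>v (R *\<^sub>v x))"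
        using SRx[OF x] SRx[OF A1x] by simp
    qed
    also have "\<dots> = A l *\<^sub>v (u *\<^sub>v (R *\<^sub>v x))"
      using assoc_mult_mat_vec[OF u Ac[OF l] Rc[OF x]] assoc_mult_mat_vec[OF Ac[OF l] u Rc[OF x]] uA[OF l] by simp
    also have "\<dots> = (A l * K) *\<^sub>v x"
      unfolding assoc_mult_mat_vec[OF Ac[OF l] K x] K_vec[OF x] ..
    finally show "(K * A1 l) *\<^sub>v x = (A l * K) *\<^sub>v x" .
  qed (use mult_carrier_mat[OF K A1c[OF l]] mult_carrier_mat[OF Ac[OF l] K] in auto)
  show ?thesis
    unfolding liberated_affine_iff[OF A] liberated_affine_iff[OF A1']
  proof
    assume "\<exists>t. torus_cocycle p q A t \<and>
      (\<forall>l \<in> carrier_vec p - {0\<^sub>v p}. \<forall>x \<in> carrier_vec q. \<not> torus_eq q (rmat (A l) *\<^sub>v x + t l) x)"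
    then obtain t where t: "torus_cocycle p q A t"
      and free: "\<forall>l \<in> carrier_vec p - {0\<^sub>v p}. \<forall>x \<in> carrier_vec q. \<not> torus_eq q (rmat (A l) *\<^sub>v x + t l) x"
      by blast
    obtain c where c: "c \<in> carrier_vec q" and ceq: "\<And>l. l \<in> carrier_vec p \<Longrightarrow>
        torus_eq q (real_of_int N \<cdot>\<^sub>v t l - rmat u *\<^sub>v t l) (rmat (A l) *\<^sub>v c - c)"
      using cu[OF t] by blast
    have "\<not> torus_eq q1 (rmat (A1 l) *\<^sub>v x + rmat S *\<^sub>v t l) x"
      if l: "l \<in> carrier_vec p - {0\<^sub>v p}" and x: "x \<in> carrier_vec q1" for l x
    proof
      have lc: "l \<in> carrier_vec p" using l by simp
      have tl: "t l \<in> carrier_vec q" by (rule torus_cocycle_carrier[OF t lc])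
      have Stl: "rmat S *\<^sub>v t l \<in> carrier_vec q1" by (rule rmat_mult_carrier[OF S tl])
      have A1x: "rmat (A1 l) *\<^sub>v x \<in> carrier_vec q1" by (rule rmat_mult_carrier[OF A1c[OF lc] x])
      have Kx: "rmat K *\<^sub>v x \<in> carrier_vec q" by (rule rmat_mult_carrier[OF K x])
      have AKx: "rmat (A l) *\<^sub>v (rmat K *\<^sub>v x) \<in> carrier_vec q" by (rule rmat_mult_carrier[OF Ac[OF lc] Kx])
      have Acc: "rmat (A l) *\<^sub>v c \<in> carrier_vec q" by (rule rmat_mult_carrier[OF Ac[OF lc] c])
      have utl: "rmat u *\<^sub>v t l \<in> carrier_vec q" by (rule rmat_mult_carrier[OF u tl])
      assume "torus_eq q1 (rmat (A1 l) *\<^sub>v x + rmat S *\<^sub>v t l) x"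
      then have "torus_eq q1 (rmat S *\<^sub>v t l) (x - rmat (A1 l) *\<^sub>v x)"
        by (simp only: torus_eq_fixed_iff[OF A1x Stl x])
      then have "torus_eq q (rmat K *\<^sub>v (rmat S *\<^sub>v t l)) (rmat K *\<^sub>v (x - rmat (A1 l) *\<^sub>v x))"
        by (rule torus_eq_mult[OF K])
      moreover have "rmat K *\<^sub>v (rmat S *\<^sub>v t l) = rmat u *\<^sub>v t l"
        using rmat_mult_vec[OF K S tl] KS by simp
      moreover have "rmat K *\<^sub>v (x - rmat (A1 l) *\<^sub>v x) = rmat K *\<^sub>v x - rmat (A l) *\<^sub>v (rmat K *\<^sub>v x)"
        using rmat_diff_vec[OF K x A1x] rmat_mult_vec[OF K A1c[OF lc] x] rmat_mult_vec[OF Ac[OF lc] K x]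
          KA[OF lc] by simp
      ultimately have "torus_eq q (rmat u *\<^sub>v t l) (rmat K *\<^sub>v x - rmat (A l) *\<^sub>v (rmat K *\<^sub>v x))" by simp
      \<comment> \<open>A fixed point x for \<open>S t\<close> makes \<open>u t l\<close> the value
        at l of a coboundary. Adding N t(l) - u t(l), the coboundary of c, shows that N t(l) is the
        value at l of the coboundary of c - K x, against freeness.\<close>
      from torus_eq_add[OF ceq[OF lc] this]
      have "torus_eq q ((real_of_int N \<cdot>\<^sub>v t l - rmat u *\<^sub>v t l) + rmat u *\<^sub>v t l)
          ((rmat (A l) *\<^sub>v c - c) + (rmat K *\<^sub>v x - rmat (A l) *\<^sub>v (rmat K *\<^sub>v x)))" .
      moreover have "(real_of_int N \<cdot>\<^sub>v t l - rmat u *\<^sub>v t l) + rmat u *\<^sub>v t l = real_of_int N \<cdot>\<^sub>v t l"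
        using tl carrier_vecD[OF utl] by (intro eq_vecI) (simp_all del: index_mult_mat_vec dim_mult_mat_vec)
      moreover have "(rmat (A l) *\<^sub>v c - c) + (rmat K *\<^sub>v x - rmat (A l) *\<^sub>v (rmat K *\<^sub>v x))
          = rmat (A l) *\<^sub>v (c - rmat K *\<^sub>v x) - (c - rmat K *\<^sub>v x)"
        unfolding rmat_diff_vec[OF Ac[OF lc] c Kx]
        using c carrier_vecD[OF Kx] carrier_vecD[OF AKx] carrier_vecD[OF Acc]
        by (intro eq_vecI) (simp_all del: index_mult_mat_vec dim_mult_mat_vec)
      ultimately show False
        using free_cocycle_multiple[OF A t free l _ N, of "c - rmat K *\<^sub>v x"] c Kx by simp
    qed
    with torus_cocycle_intertwine[OF A A1' S SA t]
    show "\<exists>t. torus_cocycle p q1 A1 t \<and>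
      (\<forall>l \<in> carrier_vec p - {0\<^sub>v p}. \<forall>x \<in> carrier_vec q1. \<not> torus_eq q1 (rmat (A1 l) *\<^sub>v x + t l) x)"
      by blast
  next
    assume "\<exists>t. torus_cocycle p q1 A1 t \<and>
      (\<forall>l \<in> carrier_vec p - {0\<^sub>v p}. \<forall>x \<in> carrier_vec q1. \<not> torus_eq q1 (rmat (A1 l) *\<^sub>v x + t l) x)"
    then obtain t where t: "torus_cocycle p q1 A1 t"
      and free: "\<forall>l \<in> carrier_vec p - {0\<^sub>v p}. \<forall>x \<in> carrier_vec q1. \<not> torus_eq q1 (rmat (A1 l) *\<^sub>v x + t l) x"
      by blast
    have "\<not> torus_eq q (rmat (A l) *\<^sub>v x + rmat K *\<^sub>v t l) x"
      if l: "l \<in> carrier_vec p - {0\<^sub>v p}" and x: "x \<in> carrier_vec q" for l x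
    proof
      have lc: "l \<in> carrier_vec p" using l by simp
      have tl: "t l \<in> carrier_vec q1" by (rule torus_cocycle_carrier[OF t lc])
      have Ktl: "rmat K *\<^sub>v t l \<in> carrier_vec q" by (rule rmat_mult_carrier[OF K tl])
      have Ax: "rmat (A l) *\<^sub>v x \<in> carrier_vec q" by (rule rmat_mult_carrier[OF Ac[OF lc] x])
      have Sx: "rmat S *\<^sub>v x \<in> carrier_vec q1" by (rule rmat_mult_carrier[OF S x])
      have ASx: "rmat (A1 l) *\<^sub>v (rmat S *\<^sub>v x) \<in> carrier_vec q1" by (rule rmat_mult_carrier[OF A1c[OF lc] Sx])
      assume "torus_eq q (rmat (A l) *\<^sub>v x + rmat K *\<^sub>v t l) x"
      then have "torus_eq q (rmat K *\<^sub>v t l) (x - rmat (A l) *\<^sub>v x)"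
        by (simp only: torus_eq_fixed_iff[OF Ax Ktl x])
      then have "torus_eq q1 (rmat S *\<^sub>v (rmat K *\<^sub>v t l)) (rmat S *\<^sub>v (x - rmat (A l) *\<^sub>v x))"
        by (rule torus_eq_mult[OF S])
      moreover have "rmat S *\<^sub>v (rmat K *\<^sub>v t l) = real_of_int N \<cdot>\<^sub>v t l"
        using rmat_mult_vec[OF S K tl] SK rmat_smult_one_vec[OF tl] by simp
      \<comment> \<open>The sign adapts x - A x to the form A w - w that
        \<open>free_cocycle_multiple\<close> expects.\<close>
      moreover have "rmat S *\<^sub>v (x - rmat (A l) *\<^sub>v x)
          = rmat (A1 l) *\<^sub>v (- (rmat S *\<^sub>v x)) - (- (rmat S *\<^sub>v x))"
      proof -
        have "rmat S *\<^sub>v (x - rmat (A l) *\<^sub>v x) = rmat S *\<^sub>v x - rmat (A1 l) *\<^sub>v (rmat S *\<^sub>v x)"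
          using rmat_diff_vec[OF S x Ax] rmat_mult_vec[OF S Ac[OF lc] x] rmat_mult_vec[OF A1c[OF lc] S x]
            SA[OF lc] by simp
        moreover have "- (rmat S *\<^sub>v x) = (- 1) \<cdot>\<^sub>v (rmat S *\<^sub>v x)" by (intro eq_vecI) auto
        then have "rmat (A1 l) *\<^sub>v (- (rmat S *\<^sub>v x)) = (- 1) \<cdot>\<^sub>v (rmat (A1 l) *\<^sub>v (rmat S *\<^sub>v x))"
          using rmat_smult_vec[OF A1c[OF lc] Sx, of "- 1"] by simp
        ultimately show ?thesis
          using carrier_vecD[OF Sx] carrier_vecD[OF ASx]
          by (simp only:) (intro eq_vecI, simp_all del: index_mult_mat_vec dim_mult_mat_vec)
      qed
      ultimately show False
        using free_cocycle_multiple[OF A1' t free l _ N, of "- (rmat S *\<^sub>v x)"] Sx by simp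
    qed
    with torus_cocycle_intertwine[OF A1' A K KA t]
    show "\<exists>t. torus_cocycle p q A t \<and>
      (\<forall>l \<in> carrier_vec p - {0\<^sub>v p}. \<forall>x \<in> carrier_vec q. \<not> torus_eq q (rmat (A l) *\<^sub>v x + t l) x)"
      by blast
  qed
qed

text \<open>\<Theta> is an abstract group isomorphism; its additivity turns the projection to
  \<int>^q1 and the inclusion of \<int>^q1 into integer matrices \<open>S\<close> and
  \<open>R\<close>, to which the quotient result applies.\<close>

theorem theorem1:
  fixes p q q1 q2 :: nat
    and A A1 A2 V :: "int vec \<Rightarrow> int mat"
    and \<Theta> :: "int vec \<times> int vec \<Rightarrow> int vec"
  assumes "p \<ge> 1" and "q \<ge> 1"
    and "lattice_action p q A"
    and "Fix p q A \<noteq> {0\<^sub>v q}"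
    and "\<Theta> \<in> iso (Zpow q1 \<times>\<times> Zpow q2) (Zpow q)"
    and "unipotent_action p q1 A1"
    and "lattice_action p q2 A2"
    and "Fix p q2 A2 = {0\<^sub>v q2}"
    and "\<And>l. l \<in> carrier (Zpow p) \<Longrightarrow> V l \<in> carrier_mat q2 q1"
    and "\<And>l l'. l \<in> carrier (Zpow p) \<Longrightarrow> l' \<in> carrier (Zpow p) \<Longrightarrow>
           V (l + l') = V l * A1 l' + A2 l * V l'"
    and "\<And>l x y. l \<in> carrier (Zpow p) \<Longrightarrow> x \<in> carrier (Zpow q1) \<Longrightarrow> y \<in> carrier (Zpow q2) \<Longrightarrow>
           A l *\<^sub>v \<Theta> (x, y) = \<Theta> (A1 l *\<^sub>v x, V l *\<^sub>v x + A2 l *\<^sub>v y)"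
  shows "liberated_affine p q A \<longleftrightarrow> liberated_affine p q1 A1"
proof -
  note \<Theta> = assms(5)
  have A: "lattice_action p q A" and A2: "lattice_action p q2 A2" and A1: "lattice_action p q1 A1"
    using assms by (auto simp: unipotent_action_def)
  have V: "V l \<in> carrier_mat q2 q1" if "l \<in> carrier_vec p" for l using assms(9) that by (simp add: monoid_vec_simps)
  have A\<Theta>: "A l *\<^sub>v \<Theta> (x, y) = \<Theta> (A1 l *\<^sub>v x, V l *\<^sub>v x + A2 l *\<^sub>v y)"
    if "l \<in> carrier_vec p" "x \<in> carrier_vec q1" "y \<in> carrier_vec q2" for l x y
    using assms(11) that by (simp add: monoid_vec_simps)
  have \<Theta>c: "\<Theta> (x, y) \<in> carrier_vec q" if "x \<in> carrier_vec q1" "y \<in> carrier_vec q2" for x y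
    using \<Theta> that by (auto simp: iso_def hom_def DirProd_def monoid_vec_simps)
  have \<Theta>add: "\<Theta> (x + x', y + y') = \<Theta> (x, y) + \<Theta> (x', y')"
    if "x \<in> carrier_vec q1" "y \<in> carrier_vec q2" "x' \<in> carrier_vec q1" "y' \<in> carrier_vec q2" for x y x' y'
    using \<Theta> that by (auto simp: iso_def hom_def DirProd_def monoid_vec_simps)
  have bij: "bij_betw \<Theta> (carrier_vec q1 \<times> carrier_vec q2) (carrier_vec q)"
    using \<Theta> by (auto simp: iso_def DirProd_def monoid_vec_simps)
  define \<pi> where "\<pi> z = fst (inv_into (carrier_vec q1 \<times> carrier_vec q2) \<Theta> z)" for z
  have \<pi>: "\<pi> (\<Theta> (x, y)) = x" if "x \<in> carrier_vec q1" "y \<in> carrier_vec q2" for x y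
    unfolding \<pi>_def using bij_betw_inv_into_left[OF bij, of "(x, y)"] that by simp
  have surj: "\<exists>x \<in> carrier_vec q1. \<exists>y \<in> carrier_vec q2. z = \<Theta> (x, y)" if "z \<in> carrier_vec q" for z
  proof -
    have "z \<in> \<Theta> ` (carrier_vec q1 \<times> carrier_vec q2)" using bij that by (simp add: bij_betw_def)
    then show ?thesis by auto
  qed
  have \<pi>c: "\<pi> z \<in> carrier_vec q1" if "z \<in> carrier_vec q" for z
    using surj[OF that] \<pi> by auto
  have \<pi>add: "\<pi> (z + z') = \<pi> z + \<pi> z'" if "z \<in> carrier_vec q" "z' \<in> carrier_vec q" for z z'
  proof -
    note z = that
    obtain x y x' y' where xy: "x \<in> carrier_vec q1" "y \<in> carrier_vec q2" "z = \<Theta> (x, y)"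
      "x' \<in> carrier_vec q1" "y' \<in> carrier_vec q2" "z' = \<Theta> (x', y')"
      using surj[OF z(1)] surj[OF z(2)] by blast
    have "z + z' = \<Theta> (x + x', y + y')" using xy \<Theta>add by simp
    then show ?thesis using xy by (simp add: \<pi>)
  qed
  obtain S where S: "S \<in> carrier_mat q1 q" and S\<pi>: "\<And>z. z \<in> carrier_vec q \<Longrightarrow> \<pi> z = S *\<^sub>v z"
    using additive_map_matrix[of q \<pi> q1, OF \<pi>c \<pi>add] by blast
  obtain R where R: "R \<in> carrier_mat q q1" and R\<Theta>: "\<And>x. x \<in> carrier_vec q1 \<Longrightarrow> \<Theta> (x, 0\<^sub>v q2) = R *\<^sub>v x"
  proof (rule additive_map_matrix[of q1 "\<lambda>x. \<Theta> (x, 0\<^sub>v q2)" q])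
    show "\<Theta> (x + y, 0\<^sub>v q2) = \<Theta> (x, 0\<^sub>v q2) + \<Theta> (y, 0\<^sub>v q2)"
      if "x \<in> carrier_vec q1" "y \<in> carrier_vec q1" for x y
      using \<Theta>add[of x "0\<^sub>v q2" y "0\<^sub>v q2"] that by simp
  qed (use \<Theta>c in auto)
  show ?thesis
  proof (rule liberated_affine_unipotent_quotient[OF A assms(6) S R])
    show "S * R = 1\<^sub>m q1"
    proof (rule mat_eqI_vec[of _ q1 q1])
      fix x :: "int vec" assume x: "x \<in> carrier_vec q1"
      have "S *\<^sub>v (R *\<^sub>v x) = x"
        using S\<pi>[of "\<Theta> (x, 0\<^sub>v q2)"] R\<Theta>[OF x] \<Theta>c[OF x zero_carrier_vec] \<pi>[OF x zero_carrier_vec] by simp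
      then show "S * R *\<^sub>v x = 1\<^sub>m q1 *\<^sub>v x" using assoc_mult_mat_vec[OF S R x] x by simp
    qed (use S R in auto)
  next
    fix l :: "int vec" assume l: "l \<in> carrier_vec p"
    note Ac = lattice_action_carrier[OF A l] and A1c = lattice_action_carrier[OF A1 l]
      and A2c = lattice_action_carrier[OF A2 l]
    show "S * A l = A1 l * S"
    proof (rule mat_eqI_vec[of _ q1 q])
      fix z :: "int vec" assume z: "z \<in> carrier_vec q"
      then obtain x y where x: "x \<in> carrier_vec q1" and y: "y \<in> carrier_vec q2" and z_eq: "z = \<Theta> (x, y)"
        using surj by blast
      have c: "A1 l *\<^sub>v x \<in> carrier_vec q1" "V l *\<^sub>v x + A2 l *\<^sub>v y \<in> carrier_vec q2"
        using x y A1c A2c V[OF l] by (auto intro: mult_mat_vec_carrier)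
      have "S *\<^sub>v (A l *\<^sub>v z) = A1 l *\<^sub>v x"
        unfolding z_eq A\<Theta>[OF l x y] S\<pi>[OF \<Theta>c[OF c], symmetric] by (rule \<pi>[OF c])
      also have "x = S *\<^sub>v z" using S\<pi>[OF z] \<pi>[OF x y] z_eq by simp
      finally show "S * A l *\<^sub>v z = A1 l * S *\<^sub>v z"
        using assoc_mult_mat_vec[OF S Ac z] assoc_mult_mat_vec[OF A1c S z] by simp
    qed (use mult_carrier_mat[OF S Ac] mult_carrier_mat[OF A1c S] in auto)
  next
    fix v assume v: "v \<in> carrier_vec q" and Sv: "S *\<^sub>v v = 0\<^sub>v q1"
      and fixed: "\<And>l. l \<in> carrier_vec p \<Longrightarrow> A l *\<^sub>v v = v"
    obtain x y where x: "x \<in> carrier_vec q1" and y: "y \<in> carrier_vec q2" and v_eq: "v = \<Theta> (x, y)"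
      using surj[OF v] by blast
    have x0: "x = 0\<^sub>v q1" using S\<pi>[OF v] \<pi>[OF x y] v_eq Sv by simp
    \<comment> \<open>A vector in the kernel of \<open>S\<close> is \<Theta>(0, y). There the V term
      vanishes, so \<open>A\<close> acts through \<open>A2\<close> on y and a fixed vector of
      \<open>A\<close> gives one of \<open>A2\<close>.\<close>
    have "A2 l *\<^sub>v y = y" if l: "l \<in> carrier_vec p" for l
    proof -
      note A1c = lattice_action_carrier[OF A1 l] and A2c = lattice_action_carrier[OF A2 l]
      have A2y: "A2 l *\<^sub>v y \<in> carrier_vec q2" using A2c y by (rule mult_mat_vec_carrier)
      have "A1 l *\<^sub>v 0\<^sub>v q1 = 0\<^sub>v q1" "V l *\<^sub>v 0\<^sub>v q1 = 0\<^sub>v q2" using A1c V[OF l] by auto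
      then have "\<Theta> (0\<^sub>v q1, A2 l *\<^sub>v y) = \<Theta> (0\<^sub>v q1, y)"
        using A\<Theta>[OF l x y] fixed[OF l] A2y unfolding v_eq x0 by simp
      then have "(0\<^sub>v q1, A2 l *\<^sub>v y) = (0\<^sub>v q1 :: int vec, y)"
        by (rule inj_onD[OF bij_betw_imp_inj_on[OF bij]]) (use y A2y in auto)
      then show ?thesis by simp
    qed
    then have "y \<in> Fix p q2 A2" using y by (simp add: Fix_def monoid_vec_simps)
    then have "y = 0\<^sub>v q2" using assms(8) by simp
    moreover have "\<Theta> (0\<^sub>v q1, 0\<^sub>v q2) = 0\<^sub>v q" using R\<Theta>[of "0\<^sub>v q1"] R by auto
    ultimately show "v = 0\<^sub>v q" using v_eq x0 by simp
  qed
qed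

end
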